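(* Let $k$ be a positive integer, and let $\ell$ be the smallest nonnegative integer such that $k+\ell$ is a prime power. Then there exists a $k$-regular graph $\Gamma$ whose energy per vertex satisfies $$\mathcal{E}(\Gamma)\geq \frac{2k+\ell+\sqrt{k+\ell}\,(k^2-\ell^2+\ell-k-2)}{(k+1)(k+\ell-1)}.$$
   Context: For a finite graph $\Gamma$ on $n$ vertices with adjacency eigenvalues $\lambda_1,\dots,\lambda_n$, the energy per vertex is $\mathcal{E}(\Gamma)=\frac1n\sum_{i=1}^n|\lambda_i|$. *)

theory Defs
  imports
    "Graph_Theory.Pair_Digraph"
    "Jordan_Normal_Form.Char_Poly"
    "HOL-Number_Theory.Prime_Powers"
begin

text \<open>
  A finite simple undirected graph is a \<^locale>\<open>pair_graph\<close>: each edge is represented by its two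
  opposite arcs, so the degree of a vertex is its out-degree.
\<close>

definition regular_graph :: "nat \<Rightarrow> 'a pair_pre_digraph \<Rightarrow> bool" where
  "regular_graph k G \<longleftrightarrow> pair_graph G \<and> (\<forall>v\<in>pverts G. out_degree (with_proj G) v = k)"

text \<open>
  The linear order on the vertices only serves to index rows and columns; any other enumeration
  gives a permutation-similar matrix.
\<close>

definition adjacency_matrix :: "'a::linorder pair_pre_digraph \<Rightarrow> complex mat" where
  "adjacency_matrix G =
     (let vs = sorted_list_of_set (pverts G); n = card (pverts G)
      in mat n n (\<lambda>(i, j). if (vs ! i, vs ! j) \<in> parcs G then 1 else 0))"

text \<open>
  Eigenvalues are counted with algebraic multiplicity. Over the complex numbers the characteristic
  polynomial splits, so that there are exactly \<open>n\<close> of them (all real for a graph).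
\<close>

definition adjacency_eigenvalues :: "'a::linorder pair_pre_digraph \<Rightarrow> complex multiset" where
  "adjacency_eigenvalues G = proots (char_poly (adjacency_matrix G))"

definition energy_per_vertex :: "'a::linorder pair_pre_digraph \<Rightarrow> real" where
  "energy_per_vertex G = (\<Sum>ev\<in>#adjacency_eigenvalues G. cmod ev) / real (card (pverts G))"

end

theory Submission
  imports Defs "Jordan_Normal_Form.Schur_Decomposition" "HOL-Algebra.Ring"
begin

text \<open>
  Put \<open>q = k + l\<close>. In the affine plane of order \<open>q\<close> consider the points other than the origin and the lines
  avoiding the origin, both sorted into \<open>q + 1\<close> classes of size \<open>q - 1\<close> according to their direction, and
  keep \<open>k + 1\<close> directions. A line meets every class except its own exactly once, so the incidence graph
  is \<open>k\<close>-regular on \<open>2 (k + 1) (q - 1)\<close> vertices. Its adjacency matrix splits into mutually annihilating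
  summands, whose energies add up: the average over sides (eigenvalues \<open>k\<close> and \<open>-k\<close>), the rest of the
  average over classes (\<open>2 k\<close> eigenvalues of modulus \<open>1\<close>), and a remainder \<open>D\<close>. All eigenvalues of \<open>D\<close> have
  modulus at most \<open>sqrt q\<close>, because before deleting directions \<open>D\<^sup>2\<close> was \<open>q\<close> times a projection, so the
  energy of \<open>D\<close> is at least \<open>tr D\<^sup>2 / sqrt q = 2 k (k + 1) (q - 2) / sqrt q\<close>.
\<close>

section \<open>Sums of absolute values of eigenvalues\<close>

text \<open>Removing the origin turns the plane into an elliptic semiplane: two points in different
  classes are joined by exactly one remaining line, while the line through two points of one class
  contains the origin and is gone; dually, two lines of one class are parallel. This regularity is
  the source of \<open>sqrt q\<close>. Deleting directions destroys it: the spectrum of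
  \<open>D\<close> is then no longer known, but a norm bound and the trace of
  \<open>D\<^sup>2\<close> survive, and these two numbers already bound the energy from below. If
  \<open>l = 0\<close> nothing is deleted, every nonzero eigenvalue of \<open>D\<close> has modulus
  \<open>sqrt q\<close>, and the estimate loses nothing. The spectral argument rests on the axioms
  of \<open>elliptic_design\<close> alone; fields serve to produce an instance for every prime
  power.\<close>

lemma trace_mult_commute:
  fixes A B :: "'a::comm_semiring_0 mat"
  assumes "A \<in> carrier_mat n m" "B \<in> carrier_mat m n"
  shows "(\<Sum>i<n. (A * B) $$ (i, i)) = (\<Sum>i<m. (B * A) $$ (i, i))"
proof -
  have "(\<Sum>i<n. (A * B) $$ (i, i)) = (\<Sum>i<n. \<Sum>j<m. A $$ (i, j) * B $$ (j, i))"
    using assms by (intro sum.cong refl) (auto simp: scalar_prod_def atLeast0LessThan)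
  also have "\<dots> = (\<Sum>j<m. \<Sum>i<n. B $$ (j, i) * A $$ (i, j))"
    by (subst sum.swap) (simp add: mult.commute)
  also have "\<dots> = (\<Sum>i<m. (B * A) $$ (i, i))"
    using assms by (intro sum.cong refl) (auto simp: scalar_prod_def atLeast0LessThan)
  finally show ?thesis .
qed

text \<open>By Schur triangularisation, \<open>A * A\<close> has the same trace as
  \<open>B * B\<close> with \<open>B\<close> upper triangular. For \<open>j \<noteq> i\<close> one
  of the entries \<open>(i, j)\<close>, \<open>(j, i)\<close> of \<open>B\<close> vanishes, so the
  diagonal of \<open>B * B\<close> consists of the squared eigenvalues.\<close>

lemma trace_square_eq_sum_eigenvalues:
  fixes A :: "complex mat"
  assumes A: "A \<in> carrier_mat n n"
  shows "(\<Sum>i<n. (A * A) $$ (i, i)) = (\<Sum>x\<in>#proots (char_poly A). x\<^sup>2)"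
proof -
  obtain as where as: "char_poly A = (\<Prod>a\<leftarrow>as. [:- a, 1:])" "length as = n"
    using char_poly_factorized[OF A] by blast
  obtain B P Q where "schur_decomposition A as = (B, P, Q)"
    by (metis prod_cases3)
  from schur_decomposition[OF A as(1) this]
  have sim: "similar_mat_wit A B P Q" and ut: "upper_triangular B" and diag: "diag_mat B = as"
    by auto
  note w = similar_mat_witD2[OF A sim]
  have "A * A = (P * B * Q) * (P * B * Q)" using w(3) by simp
  also have "\<dots> = P * (B * (Q * P) * B * Q)"
    using w(4-7) by (simp add: assoc_mult_mat[of _ n n _ n _ n])
  also have "\<dots> = P * (B * B * Q)"
    using w(2,4-7) by simp
  finally have AA: "A * A = P * (B * B * Q)" .
  have "(\<Sum>i<n. (A * A) $$ (i, i)) = (\<Sum>i<n. ((B * B * Q) * P) $$ (i, i))"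
    unfolding AA by (rule trace_mult_commute) (use w in auto)
  also have "(B * B * Q) * P = B * B"
    using w(2,4-7) by (simp add: assoc_mult_mat[of _ n n _ n _ n])
  also have "(\<Sum>i<n. (B * B) $$ (i, i)) = (\<Sum>i<n. (B $$ (i, i))\<^sup>2)"
  proof (intro sum.cong refl)
    fix i assume i: "i \<in> {..<n}"
    have "(B * B) $$ (i, i) = (\<Sum>j<n. B $$ (i, j) * B $$ (j, i))"
      using i w(5) by (auto simp: scalar_prod_def atLeast0LessThan)
    also have "\<dots> = (\<Sum>j<n. if j = i then (B $$ (i, i))\<^sup>2 else 0)"
    proof (intro sum.cong refl)
      fix j assume j: "j \<in> {..<n}"
      show "B $$ (i, j) * B $$ (j, i) = (if j = i then (B $$ (i, i))\<^sup>2 else 0)"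
        using ut i j w(5) by (cases i j rule: linorder_cases) (auto simp: upper_triangular_def power2_eq_square)
    qed
    also have "\<dots> = (B $$ (i, i))\<^sup>2" using i by simp
    finally show "(B * B) $$ (i, i) = (B $$ (i, i))\<^sup>2" .
  qed
  also have "\<dots> = (\<Sum>a\<leftarrow>diag_mat B. a\<^sup>2)"
    using w(5) by (simp add: diag_mat_def sum_list_sum_nth atLeast0LessThan)
  also have "\<dots> = (\<Sum>x\<in>#mset as. x\<^sup>2)"
    unfolding diag by (simp flip: sum_mset_sum_list)
  also have "mset as = proots (char_poly A)"
    unfolding as(1) by (induction as) (simp_all add: proots_mult image_iff del: mult_pCons_left)
  finally show ?thesis .
qed

text \<open>Since \<open>\<bar>t\<bar> \<ge> \<bar>t\<^sup>2\<bar> / s\<close> for \<open>\<bar>t\<bar> \<le> s\<close>.\<close>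
lemma sum_cmod_eigenvalues_ge:
  fixes A :: "complex mat"
  assumes A: "A \<in> carrier_mat n n" and s: "s > 0"
    and bound: "\<And>x. eigenvalue A x \<Longrightarrow> cmod x \<le> s"
  shows "(\<Sum>x\<in>#proots (char_poly A). cmod x) \<ge> Re (\<Sum>i<n. (A * A) $$ (i, i)) / s"
proof -
  have nz: "char_poly A \<noteq> 0"
    using degree_monic_char_poly[OF A] by auto
  have *: "Re (x\<^sup>2) / s \<le> cmod x" if "x \<in># proots (char_poly A)" for x
  proof -
    have "cmod x \<le> s"
      using that nz bound eigenvalue_root_char_poly[OF A] by simp
    have "Re (x\<^sup>2) \<le> cmod (x\<^sup>2)" by (rule complex_Re_le_cmod)
    also have "\<dots> = cmod x * cmod x" by (simp add: norm_mult power2_eq_square)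
    also have "\<dots> \<le> cmod x * s" by (intro mult_left_mono) (use \<open>cmod x \<le> s\<close> in auto)
    finally show ?thesis using s by (simp add: field_simps)
  qed
  have "Re (\<Sum>x\<in>#M. x\<^sup>2) / s = (\<Sum>x\<in>#M. Re (x\<^sup>2) / s)" for M
    by (induction M) (simp_all add: add_divide_distrib)
  then have "Re (\<Sum>i<n. (A * A) $$ (i, i)) / s = (\<Sum>x\<in>#proots (char_poly A). Re (x\<^sup>2) / s)"
    by (simp add: trace_square_eq_sum_eigenvalues[OF A])
  also have "\<dots> \<le> (\<Sum>x\<in>#proots (char_poly A). cmod x)"
    by (rule sum_mset_mono) (rule *)
  finally show ?thesis .
qed

text \<open>If \<open>X * Y = 0\<close> then \<open>(t - X) * (t - Y) = t * (t - (X + Y))\<close>.\<close>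
lemma char_poly_add_of_mult_eq_zero:
  fixes X Y :: "'a::comm_ring_1 mat"
  assumes X: "X \<in> carrier_mat n n" and Y: "Y \<in> carrier_mat n n" and XY: "X * Y = 0\<^sub>m n n"
  shows "char_poly X * char_poly Y = [:0, 1:] ^ n * char_poly (X + Y)"
proof -
  have "char_poly_matrix X * char_poly_matrix Y = [:0, 1:] \<cdot>\<^sub>m char_poly_matrix (X + Y)"
  proof (rule eq_matI)
    fix i j assume "i < dim_row ([:0, 1:] \<cdot>\<^sub>m char_poly_matrix (X + Y))"
      "j < dim_col ([:0, 1:] \<cdot>\<^sub>m char_poly_matrix (X + Y))"
    then have ij: "i < n" "j < n"
      using X Y by (auto simp: char_poly_matrix_def)
    define x :: "'a poly" where "x = [:0, 1:]"
    define d where "d a b = (if a = b then x else 0)" for a b :: nat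
    have "(\<Sum>t<n. X $$ (i, t) * Y $$ (t, j)) = (X * Y) $$ (i, j)"
      using ij X Y by (auto simp: scalar_prod_def atLeast0LessThan)
    then have 0: "(\<Sum>t<n. X $$ (i, t) * Y $$ (t, j)) = 0"
      using ij by (simp add: XY)
    have const_sum: "(\<Sum>t<n. [:f t:]) = [:\<Sum>t<n. f t:]" for f :: "nat \<Rightarrow> 'a"
      by (induction n) auto
    have "(char_poly_matrix X * char_poly_matrix Y) $$ (i, j)
      = (\<Sum>t<n. (d i t - [:X $$ (i, t):]) * (d t j - [:Y $$ (t, j):]))"
      using ij X Y
      by (auto simp: scalar_prod_def atLeast0LessThan char_poly_matrix_def d_def x_def intro!: sum.cong)
    also have "\<dots> = (\<Sum>t<n. (if i = t then x * d t j else 0)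
        - (if i = t then x * [:Y $$ (t, j):] else 0)
        - (if t = j then x * [:X $$ (i, t):] else 0) + [:X $$ (i, t) * Y $$ (t, j):])"
      by (intro sum.cong refl) (auto simp: d_def algebra_simps)
    also have "\<dots> = x * d i j - x * [:Y $$ (i, j):] - x * [:X $$ (i, j):]"
      using ij by (simp add: sum.distrib sum_subtractf const_sum 0)
    also have "\<dots> = ([:0, 1:] \<cdot>\<^sub>m char_poly_matrix (X + Y)) $$ (i, j)"
      using ij X Y by (auto simp: char_poly_matrix_def d_def x_def algebra_simps)
    finally show "(char_poly_matrix X * char_poly_matrix Y) $$ (i, j)
      = ([:0, 1:] \<cdot>\<^sub>m char_poly_matrix (X + Y)) $$ (i, j)" .
  qed (use X Y in \<open>auto simp: char_poly_matrix_def\<close>)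
  then have "det (char_poly_matrix X * char_poly_matrix Y) = det ([:0, 1:] \<cdot>\<^sub>m char_poly_matrix (X + Y))"
    by simp
  moreover have "dim_col (char_poly_matrix (X + Y)) = n"
    using Y by (auto simp: char_poly_matrix_def)
  ultimately show ?thesis
    using X Y by (simp add: det_mult[of _ n] char_poly_def)
qed

text \<open>The factor \<open>[:0, 1:] ^ n\<close> contributes only zero eigenvalues, which do not
  change the sum of the moduli.\<close>

lemma sum_cmod_eigenvalues_add:
  fixes X Y :: "complex mat"
  assumes X: "X \<in> carrier_mat n n" and Y: "Y \<in> carrier_mat n n" and XY: "X * Y = 0\<^sub>m n n"
  shows "(\<Sum>x\<in>#proots (char_poly (X + Y)). cmod x)
    = (\<Sum>x\<in>#proots (char_poly X). cmod x) + (\<Sum>x\<in>#proots (char_poly Y). cmod x)"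
proof -
  have nz: "char_poly M \<noteq> 0" if "M \<in> carrier_mat n n" for M :: "complex mat"
    using degree_monic_char_poly[OF that] by auto
  have "proots (char_poly X) + proots (char_poly Y) = repeat_mset n {#0#} + proots (char_poly (X + Y))"
    using arg_cong[OF char_poly_add_of_mult_eq_zero[OF X Y XY], of proots] nz X Y
    by (simp add: proots_mult proots_power)
  from arg_cong[OF this, of "\<lambda>M. \<Sum>x\<in>#M. cmod x"] show ?thesis
    by (simp add: sum_mset_constant)
qed

section \<open>The incidence graph of a punctured affine plane\<close>

text \<open>Every eigenvalue satisfies \<open>x ^ 3 = c\<^sup>2 * x\<close>. The cube is used
  because the squares of the averaged matrices below are multiples of projections, not of the
  identity.\<close>

lemma cmod_eigenvalue_le_of_cube:
  fixes M :: "complex mat"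
  assumes M: "M \<in> carrier_mat n n" and c: "c \<ge> 0"
    and cube: "M * (M * M) = (of_real c)\<^sup>2 \<cdot>\<^sub>m M" and ev: "eigenvalue M x"
  shows "cmod x \<le> c"
proof -
  obtain v where v: "v \<in> carrier_vec n" "v \<noteq> 0\<^sub>v n" "M *\<^sub>v v = x \<cdot>\<^sub>v v"
    using ev M by (auto simp: eigenvalue_def eigenvector_def)
  obtain i where i: "i < n" "v $ i \<noteq> 0"
    using v(1,2) by (metis carrier_vecD eq_vecI index_zero_vec)
  have "(M * (M * M)) *\<^sub>v v = M *\<^sub>v (M *\<^sub>v (M *\<^sub>v v))"
    using M v(1) by (simp add: assoc_mult_mat_vec[of _ n n _ n])
  also have "\<dots> = x \<cdot>\<^sub>v (x \<cdot>\<^sub>v (x \<cdot>\<^sub>v v))"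
    using M v by (simp add: mult_mat_vec[of M n n])
  also have "(M * (M * M)) *\<^sub>v v = (of_real c)\<^sup>2 \<cdot>\<^sub>v (x \<cdot>\<^sub>v v)"
    unfolding cube v(3)[symmetric] using M v(1)
    by (intro eq_vecI) (auto simp: smult_scalar_prod_distrib[of _ n])
  finally have "((of_real c)\<^sup>2 \<cdot>\<^sub>v (x \<cdot>\<^sub>v v)) $ i = (x \<cdot>\<^sub>v (x \<cdot>\<^sub>v (x \<cdot>\<^sub>v v))) $ i"
    by simp
  then have "x = 0 \<or> x\<^sup>2 = (of_real c)\<^sup>2"
    using i v(1) by (auto simp: power2_eq_square)
  then show ?thesis
    using c by (auto simp: power2_eq_iff)
qed

text \<open>
  The model is the affine plane of order \<open>q\<close> without its origin: the vertices with \<open>side\<close> false are the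
  points other than the origin, those with \<open>side\<close> true are the lines avoiding the origin, and \<open>grp\<close> is
  the direction (of the position vector of a point, or of a line), one of \<open>q + 1\<close>. Every natural number
  is a vertex for convenience, but only those with \<open>grp \<le> q\<close> matter.
\<close>
locale elliptic_design =
  fixes q r :: nat and grp :: "nat \<Rightarrow> nat" and side :: "nat \<Rightarrow> bool"
    and adj :: "nat \<Rightarrow> nat \<Rightarrow> bool"
  assumes r_pos: "r > 0" and q_eq: "q = r + 1"
    and grp_less_iff: "\<And>v j. grp v < j \<longleftrightarrow> v < 2 * j * r"
    and card_class: "\<And>\<gamma> \<sigma>. card {v. grp v = \<gamma> \<and> side v = \<sigma>} = r"
    and adj_sym: "\<And>u v. adj u v \<longleftrightarrow> adj v u"
    and adj_side: "\<And>u v. adj u v \<Longrightarrow> side u \<noteq> side v"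
    and adj_grp: "\<And>u v. adj u v \<Longrightarrow> grp u \<noteq> grp v"
    and ex1_adj: "\<And>u j. grp u \<le> q \<Longrightarrow> j \<le> q \<Longrightarrow> j \<noteq> grp u \<Longrightarrow> \<exists>!v. grp v = j \<and> adj u v"
    and ex1_common: "\<And>u v. grp u \<le> q \<Longrightarrow> grp v \<le> q \<Longrightarrow> side u = side v \<Longrightarrow> grp u \<noteq> grp v
      \<Longrightarrow> \<exists>!w. grp w \<le> q \<and> adj u w \<and> adj v w"
begin

definition cls :: "nat \<Rightarrow> bool \<Rightarrow> nat set" where
  "cls \<gamma> \<sigma> = {v. grp v = \<gamma> \<and> side v = \<sigma>}"

lemma card_cls: "card (cls \<gamma> \<sigma>) = r"
  using card_class by (simp add: cls_def)

lemma finite_cls: "finite (cls \<gamma> \<sigma>)"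
  using card_cls r_pos by (metis card.infinite less_irrefl)

text \<open>The numbering makes the first \<open>j\<close> directions an initial segment of the
  natural numbers, so a sum over the kept vertices splits into sums over whole classes.\<close>

lemma sum_classes:
  "(\<Sum>v<2 * j * r. f v) = (\<Sum>\<gamma><j. \<Sum>\<sigma>\<in>UNIV. \<Sum>v\<in>cls \<gamma> \<sigma>. f v)"
proof -
  have "(\<Sum>\<gamma><j. \<Sum>\<sigma>\<in>UNIV. \<Sum>v\<in>cls \<gamma> \<sigma>. f v)
    = (\<Sum>p\<in>{..<j} \<times> UNIV. \<Sum>v\<in>{v \<in> {..<2 * j * r}. (grp v, side v) = p}. f v)"
    by (auto simp: sum.cartesian_product cls_def grp_less_iff intro!: sum.cong)
  also have "\<dots> = (\<Sum>v<2 * j * r. f v)"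
    by (rule sum.group) (auto simp: grp_less_iff)
  finally show ?thesis ..
qed

lemma sum_class_function:
  fixes f :: "nat \<Rightarrow> bool \<Rightarrow> 'a::comm_semiring_1"
  shows "(\<Sum>v<2 * j * r. f (grp v) (side v)) = of_nat r * (\<Sum>\<gamma><j. f \<gamma> True + f \<gamma> False)"
proof -
  have "(\<Sum>v\<in>cls \<gamma> \<sigma>. f (grp v) (side v)) = of_nat r * f \<gamma> \<sigma>" for \<gamma> \<sigma>
    by (subst sum.cong[of _ _ _ "\<lambda>_. f \<gamma> \<sigma>"]) (auto simp: cls_def card_class)
  then show ?thesis
    unfolding sum_classes by (simp add: UNIV_bool sum_distrib_left distrib_left add.commute)
qed

definition a :: "nat \<Rightarrow> nat \<Rightarrow> complex" where
  "a u v = of_bool (adj u v)"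

lemma a_sym: "a u v = a v u"
  by (simp add: a_def adj_sym[of u v])

text \<open>The block of \<open>a\<close> between two classes is a permutation matrix if the classes
  differ in both side and direction, and zero otherwise.\<close>

lemma sum_cls_a:
  assumes "\<gamma> \<le> q" "grp u \<le> q"
  shows "(\<Sum>v\<in>cls \<gamma> \<sigma>. a u v) = of_bool (\<sigma> \<noteq> side u \<and> \<gamma> \<noteq> grp u)"
proof (cases "\<sigma> \<noteq> side u \<and> \<gamma> \<noteq> grp u")
  case True
  then obtain w where w: "grp w = \<gamma>" "adj u w" "\<And>v. grp v = \<gamma> \<Longrightarrow> adj u v \<Longrightarrow> v = w"
    using ex1_adj[OF assms(2,1)] by metis
  have "adj u v \<longleftrightarrow> v = w" if "v \<in> cls \<gamma> \<sigma>" for v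
    using that w by (metis (mono_tags) cls_def mem_Collect_eq)
  then have "(\<Sum>v\<in>cls \<gamma> \<sigma>. a u v) = (\<Sum>v\<in>cls \<gamma> \<sigma>. of_bool (v = w))"
    by (simp add: a_def)
  also have "w \<in> cls \<gamma> \<sigma>"
    using True w(1) adj_side[OF w(2)] by (auto simp: cls_def)
  then have "(\<Sum>v\<in>cls \<gamma> \<sigma>. of_bool (v = w)) = (1::complex)"
    using finite_cls by (simp add: of_bool_def)
  finally show ?thesis using True by simp
next
  case False
  then have "a u v = 0" if "v \<in> cls \<gamma> \<sigma>" for v
    using that adj_side[of u v] adj_grp[of u v] by (auto simp: a_def cls_def)
  with False show ?thesis by simp
qed

lemma sum_a:
  assumes "grp u \<le> q" "j \<le> q + 1"
  shows "(\<Sum>v<2 * j * r. a u v) = of_nat (card ({..<j} - {grp u}))"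
proof -
  have "(\<Sum>v<2 * j * r. a u v) = (\<Sum>\<gamma><j. \<Sum>\<sigma>\<in>UNIV. of_bool (\<sigma> \<noteq> side u \<and> \<gamma> \<noteq> grp u))"
    unfolding sum_classes using assms by (intro sum.cong refl sum_cls_a) auto
  also have "\<dots> = (\<Sum>\<gamma><j. of_bool (\<gamma> \<noteq> grp u))"
    by (intro sum.cong refl) (auto simp: UNIV_bool)
  also have "\<dots> = of_nat (card ({..<j} - {grp u}))"
    by (simp add: of_bool_def Diff_eq Int_def flip: sum.inter_filter) 
  finally show ?thesis .
qed

text \<open>These are the entries of the square of the full adjacency matrix. The number
  \<open>q\<close> counts the neighbours of a vertex, one in each other direction; the second term
  is constant on pairs of classes and therefore disappears on vectors with zero class sums.\<close>

lemma sum_a_mult_a: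
  assumes "grp u \<le> q" "grp v \<le> q"
  shows "(\<Sum>w<2 * (q + 1) * r. a w u * a w v)
    = of_bool (u = v) * of_nat q + of_bool (side u = side v \<and> grp u \<noteq> grp v)"
proof -
  consider "u = v" | "side u = side v" "grp u \<noteq> grp v" | "side u \<noteq> side v"
    | "u \<noteq> v" "grp u = grp v" by blast
  then show ?thesis
  proof cases
    case 1
    have "(\<Sum>w<2 * (q + 1) * r. a w u * a w v) = (\<Sum>w<2 * (q + 1) * r. a u w)"
      using 1 a_sym[of u] by (intro sum.cong refl) (auto simp: a_def)
    also have "\<dots> = of_nat (card ({..<q + 1} - {grp u}))"
      using sum_a[of u "q + 1"] assms by simp
    finally show ?thesis using 1 assms by simp
  next
    case 2
    obtain x where x: "grp x \<le> q" "adj u x" "adj v x"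
      "\<And>w. grp w \<le> q \<Longrightarrow> adj u w \<Longrightarrow> adj v w \<Longrightarrow> w = x"
      using ex1_common[OF assms 2] by metis
    have "(\<Sum>w<2 * (q + 1) * r. a w u * a w v) = (\<Sum>w<2 * (q + 1) * r. of_bool (w = x))"
    proof (intro sum.cong refl)
      fix w assume "w \<in> {..<2 * (q + 1) * r}"
      then have "grp w \<le> q" using grp_less_iff[of w "q + 1"] by auto
      then have "adj w u \<and> adj w v \<longleftrightarrow> w = x"
        using x adj_sym by metis
      then show "a w u * a w v = of_bool (w = x)"
        by (simp add: a_def flip: of_bool_conj)
    qed
    also have "x < 2 * (q + 1) * r" using grp_less_iff[of x "q + 1"] x(1) by auto
    then have "(\<Sum>w<2 * (q + 1) * r. of_bool (w = x)) = (1::complex)"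
      by (simp add: of_bool_def)
    finally show ?thesis using 2 by auto
  next
    case 3
    have "a w u * a w v = 0" for w
      using 3 adj_side[of w u] adj_side[of w v] by (auto simp: a_def)
    then show ?thesis using 3 by auto
  next
    case 4
    have "a w u * a w v = 0" if "w < 2 * (q + 1) * r" for w
    proof (rule ccontr)
      assume "a w u * a w v \<noteq> 0"
      then have *: "adj w u" "adj w v" by (auto simp: a_def)
      have "grp w \<le> q" using grp_less_iff[of w "q + 1"] that by auto
      from ex1_adj[OF this assms(1)] adj_grp[OF *(1)] have "\<exists>!x. grp x = grp u \<and> adj w x" by metis
      with * 4 show False by metis
    qed
    then have "(\<Sum>w<2 * (q + 1) * r. a w u * a w v) = 0"
      by (intro sum.neutral) simp
    then show ?thesis using 4 by simp
  qed
qed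

end

section \<open>Restriction to \<open>K\<close> directions: class averages and the remainder\<close>

locale elliptic_subdesign = elliptic_design +
  fixes K :: nat
  assumes K_pos: "K > 0" and K_le: "K \<le> q + 1"
begin

abbreviation (input) n :: nat where "n \<equiv> 2 * K * r"

text \<open>
  Below, \<open>x\<close> is the average of the adjacency matrix \<open>a\<close> over pairs of classes, \<open>x0\<close> is the average over
  pairs of sides, and \<open>a = x0 + x1 + d\<close>; \<open>e0\<close> and \<open>e1\<close> are the squares of \<open>x0\<close> and \<open>x1\<close>.
\<close>
definition h :: "nat \<Rightarrow> nat \<Rightarrow> complex" where
  "h \<gamma> \<delta> = of_bool (\<gamma> = \<delta>) / of_nat r - 1 / of_nat (K * r)"

definition x0 :: "nat \<Rightarrow> nat \<Rightarrow> complex" where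
  "x0 u v = of_bool (side u \<noteq> side v) * (of_nat (K - 1) / of_nat (K * r))"

definition x1 :: "nat \<Rightarrow> nat \<Rightarrow> complex" where
  "x1 u v = - (of_bool (side u \<noteq> side v) * h (grp u) (grp v))"

definition x :: "nat \<Rightarrow> nat \<Rightarrow> complex" where
  "x u v = of_bool (side u \<noteq> side v \<and> grp u \<noteq> grp v) / of_nat r"

definition d :: "nat \<Rightarrow> nat \<Rightarrow> complex" where
  "d u v = a u v - x u v"

text \<open>For opposite sides the block average is
  \<open>of_bool (grp u \<noteq> grp v) / r\<close>; subtracting the overall average
  \<open>(K - 1) / (K * r)\<close> leaves \<open>- h\<close>, which explains the sign in
  \<open>x1\<close>.\<close>

lemma x_eq: "x u v = x0 u v + x1 u v"
  using K_pos r_pos by (auto simp: x_def x0_def x1_def h_def field_simps of_nat_diff)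

lemma grp_less: "u < n \<Longrightarrow> grp u < K"
  by (simp add: grp_less_iff)

lemma grp_le: "u < n \<Longrightarrow> grp u \<le> q"
  using grp_less[of u] K_le by simp

lemma sum_h: "\<delta> < K \<Longrightarrow> (\<Sum>\<gamma><K. h \<gamma> \<delta>) = 0"
  using K_pos r_pos by (simp add: h_def sum_subtractf of_bool_def flip: sum_divide_distrib)

text \<open>On one side, \<open>h (grp u) (grp v)\<close> is the averaging projection over classes
  minus the averaging projection over the whole side, hence again a projection. The factor
  \<open>1 / r\<close> appears because the sum runs over classes, each standing for \<open>r\<close>
  vertices.\<close>

lemma sum_h_mult_h:
  assumes "\<gamma> < K" "\<delta> < K"
  shows "(\<Sum>\<epsilon><K. h \<gamma> \<epsilon> * h \<epsilon> \<delta>) = h \<gamma> \<delta> / of_nat r"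
proof -
  have "h \<gamma> \<epsilon> * t = (if \<epsilon> = \<gamma> then t / of_nat r else 0) - t / of_nat (K * r)" for \<epsilon> t
    by (simp add: h_def algebra_simps)
  then have "(\<Sum>\<epsilon><K. h \<gamma> \<epsilon> * h \<epsilon> \<delta>)
    = (\<Sum>\<epsilon><K. (if \<epsilon> = \<gamma> then h \<epsilon> \<delta> / of_nat r else 0) - h \<epsilon> \<delta> / of_nat (K * r))"
    by (simp only:)
  also have "\<dots> = h \<gamma> \<delta> / of_nat r"
    using assms sum_h[of \<delta>] by (simp add: sum_subtractf flip: sum_divide_distrib)
  finally show ?thesis .
qed

text \<open>Rows of \<open>x0\<close> are constant on each side, and columns of \<open>x1\<close>
  sum to zero on each side by \<open>sum_h\<close>.\<close>

lemma sum_x0_mult_x1: "v < n \<Longrightarrow> (\<Sum>w<n. x0 u w * x1 w v) = 0"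
  using sum_class_function[where j = K and
      f = "\<lambda>\<gamma> \<sigma>. of_bool (side u \<noteq> \<sigma>) * (of_nat (K - 1) / of_nat (K * r))
        * - (of_bool (\<sigma> \<noteq> side v) * h \<gamma> (grp v))"] sum_h[of "grp v"] grp_less[of v]
  by (cases "side u"; cases "side v")
     (auto simp: x0_def x1_def sum_negf simp flip: sum_distrib_left sum_divide_distrib)

definition e0 :: "nat \<Rightarrow> nat \<Rightarrow> complex" where
  "e0 u v = of_bool (side u = side v) * (of_nat ((K - 1)\<^sup>2) / of_nat (K * r))"

definition e1 :: "nat \<Rightarrow> nat \<Rightarrow> complex" where
  "e1 u v = of_bool (side u = side v) * h (grp u) (grp v)"

lemma sum_of_bool_side: "(\<Sum>w<n. of_bool (side w = \<sigma>)) = (of_nat (K * r) :: complex)"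
  using sum_class_function[where j = K and f = "\<lambda>_ \<tau>. of_bool (\<tau> = \<sigma>) :: complex"] by (cases \<sigma>) auto

lemma sum_x0_mult_x0: "(\<Sum>w<n. x0 u w * x0 w v) = e0 u v"
proof -
  define c :: complex where "c = of_nat (K - 1) / of_nat (K * r)"
  have "(\<Sum>w<n. x0 u w * x0 w v)
    = (\<Sum>w<n. of_bool (side u = side v) * c * c * of_bool (side w = (\<not> side u)))"
    by (intro sum.cong refl) (auto simp: x0_def c_def)
  also have "\<dots> = of_bool (side u = side v) * c * c * of_nat (K * r)"
    unfolding sum_distrib_left[symmetric] sum_of_bool_side ..
  also have "\<dots> = e0 u v"
    using K_pos r_pos unfolding e0_def c_def power2_eq_square of_nat_mult by simp
  finally show ?thesis .
qed

lemma sum_x0_mult_e0: "(\<Sum>w<n. x0 u w * e0 w v) = (of_nat (K - 1))\<^sup>2 * x0 u v"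
proof -
  define c :: complex where "c = of_nat (K - 1) / of_nat (K * r)"
  have "(\<Sum>w<n. x0 u w * e0 w v)
    = (\<Sum>w<n. of_bool (side u \<noteq> side v) * c * of_nat (K - 1) * c * of_bool (side w = (\<not> side u)))"
    by (intro sum.cong refl) (auto simp: x0_def e0_def c_def power2_eq_square)
  also have "\<dots> = of_bool (side u \<noteq> side v) * c * of_nat (K - 1) * c * of_nat (K * r)"
    unfolding sum_distrib_left[symmetric] sum_of_bool_side ..
  also have "\<dots> = (of_nat (K - 1))\<^sup>2 * x0 u v"
    using K_pos r_pos unfolding x0_def c_def power2_eq_square of_nat_mult by simp
  finally show ?thesis .
qed

lemma sum_x1_mult_x1: "u < n \<Longrightarrow> v < n \<Longrightarrow> (\<Sum>w<n. x1 u w * x1 w v) = e1 u v"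
  using sum_class_function[where j = K and
      f = "\<lambda>\<gamma> \<sigma>. - (of_bool (side u \<noteq> \<sigma>) * h (grp u) \<gamma>)
        * - (of_bool (\<sigma> \<noteq> side v) * h \<gamma> (grp v))"]
    sum_h_mult_h[of "grp u" "grp v"] grp_less[of u] grp_less[of v] r_pos
  by (cases "side u"; cases "side v") (auto simp: x1_def e1_def)

lemma sum_x1_mult_e1: "u < n \<Longrightarrow> v < n \<Longrightarrow> (\<Sum>w<n. x1 u w * e1 w v) = x1 u v"
  using sum_class_function[where j = K and
      f = "\<lambda>\<gamma> \<sigma>. - (of_bool (side u \<noteq> \<sigma>) * h (grp u) \<gamma>)
        * (of_bool (\<sigma> = side v) * h \<gamma> (grp v))"]
    sum_h_mult_h[of "grp u" "grp v"] grp_less[of u] grp_less[of v] r_pos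
  by (cases "side u"; cases "side v") (auto simp: x1_def e1_def sum_negf)

lemma sum_cls_d:
  assumes "\<gamma> < K" "u < n"
  shows "(\<Sum>v\<in>cls \<gamma> \<sigma>. d v u) = 0"
proof -
  have "(\<Sum>v\<in>cls \<gamma> \<sigma>. x v u) = (\<Sum>v\<in>cls \<gamma> \<sigma>. of_bool (\<sigma> \<noteq> side u \<and> \<gamma> \<noteq> grp u) / of_nat r)"
    by (intro sum.cong refl) (auto simp: x_def cls_def)
  also have "\<dots> = of_bool (\<sigma> \<noteq> side u \<and> \<gamma> \<noteq> grp u)"
    using r_pos by (simp add: card_cls)
  finally show ?thesis
    using sum_cls_a[of \<gamma> u \<sigma>] assms K_le grp_le[of u]
    by (simp add: d_def sum_subtractf a_sym[of _ u])
qed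

text \<open>Rows of \<open>x\<close> are constant on classes. Applied to the columns of
  \<open>d\<close> this gives \<open>x * d = 0\<close>; applied to eigenvectors it allows
  \<open>d\<close> to be replaced by \<open>a\<close>.\<close>

lemma sum_x_mult_eq_zero:
  assumes "\<And>\<gamma> \<sigma>. \<gamma> < K \<Longrightarrow> (\<Sum>v\<in>cls \<gamma> \<sigma>. f v) = 0"
  shows "(\<Sum>v<n. x u v * f v) = 0"
proof -
  have "(\<Sum>v\<in>cls \<gamma> \<sigma>. x u v * f v) = 0" if "\<gamma> < K" for \<gamma> \<sigma>
  proof -
    have "(\<Sum>v\<in>cls \<gamma> \<sigma>. x u v * f v)
      = (\<Sum>v\<in>cls \<gamma> \<sigma>. of_bool (side u \<noteq> \<sigma> \<and> grp u \<noteq> \<gamma>) / of_nat r * f v)"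
      by (intro sum.cong refl) (auto simp: x_def cls_def)
    also have "\<dots> = 0"
      unfolding sum_distrib_left[symmetric] assms[OF that] by simp
    finally show ?thesis .
  qed
  then show ?thesis
    unfolding sum_classes by simp
qed

lemma sum_a_mult: "u < n \<Longrightarrow> (\<Sum>v<n. a u v * a v u) = of_nat (K - 1)"
proof -
  assume u: "u < n"
  have "(\<Sum>v<n. a u v * a v u) = (\<Sum>v<n. a u v)"
    by (intro sum.cong refl) (auto simp: a_sym[of _ u], simp add: a_def)
  then show ?thesis
    using sum_a[of u K] grp_le[OF u] grp_less[OF u] K_le by simp
qed

text \<open>Since \<open>x * d = 0\<close>, one factor \<open>d\<close> may be replaced by
  \<open>a\<close>, and wherever \<open>a\<close> is nonzero the other factor equals
  \<open>1 - 1 / r\<close>. The diagonal thus depends only on the degree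
  \<open>K - 1\<close>.\<close>

lemma sum_d_mult_d:
  assumes u: "u < n"
  shows "(\<Sum>v<n. d u v * d v u) = of_nat (K - 1) - of_nat (K - 1) / of_nat r"
proof -
  have "(\<Sum>v<n. d u v * d v u) = (\<Sum>v<n. a u v * d v u) - (\<Sum>v<n. x u v * d v u)"
    by (simp add: d_def algebra_simps sum_subtractf)
  also have "(\<Sum>v<n. x u v * d v u) = 0"
    using u by (intro sum_x_mult_eq_zero sum_cls_d)
  also have "(\<Sum>v<n. a u v * d v u) = (\<Sum>v<n. a u v * a v u - a u v * a v u / of_nat r)"
  proof (intro sum.cong refl)
    fix v
    show "a u v * d v u = a u v * a v u - a u v * a v u / of_nat r"
      using adj_side[of u v] adj_grp[of u v] adj_sym[of u v]
      by (cases "adj u v") (auto simp: d_def a_def x_def)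
  qed
  also have "\<dots> = of_nat (K - 1) - of_nat (K - 1) / of_nat r"
    using sum_a_mult[OF u] by (simp add: sum_subtractf flip: sum_divide_distrib)
  finally show ?thesis by simp
qed

text \<open>
  On vectors with zero class sums, the full incidence structure acts as \<open>sqrt q\<close> times an isometry, and
  passing to \<open>K\<close> of the directions only drops coordinates of the image.
\<close>
lemma sum_norm_a_mult_le:
  assumes zero: "\<And>\<gamma> \<sigma>. \<gamma> < K \<Longrightarrow> (\<Sum>v\<in>cls \<gamma> \<sigma>. w v) = 0"
  shows "(\<Sum>u<n. (cmod (\<Sum>v<n. a u v * w v))\<^sup>2) \<le> q * (\<Sum>v<n. (cmod (w v))\<^sup>2)"
proof -
  let ?N = "2 * (q + 1) * r"
  define y where "y u = (\<Sum>v<n. a u v * w v)" for u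
  \<comment> \<open>The off-diagonal part of \<open>sum_a_mult_a\<close> is constant on pairs of
    classes, so the vanishing class sums of \<open>w\<close> cancel it.\<close>
  have cross: "(\<Sum>t<n. of_bool (side s = side t \<and> grp s \<noteq> grp t) * cnj (w t)) = 0" for s
  proof -
    have "(\<Sum>t<n. of_bool (side s = side t \<and> grp s \<noteq> grp t) * cnj (w t))
      = (\<Sum>\<gamma><K. \<Sum>\<sigma>\<in>UNIV. of_bool (side s = \<sigma> \<and> grp s \<noteq> \<gamma>) * cnj (\<Sum>t\<in>cls \<gamma> \<sigma>. w t))"
      unfolding sum_classes cnj_sum sum_distrib_left
      by (intro sum.cong refl) (auto simp: cls_def)
    also have "\<dots> = 0" using zero by simp
    finally show ?thesis .
  qed
  have "complex_of_real (\<Sum>u<?N. (cmod (y u))\<^sup>2) = (\<Sum>u<?N. y u * cnj (y u))"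
    by (simp only: of_real_sum complex_norm_square)
  also have "\<dots> = (\<Sum>u<?N. \<Sum>s<n. \<Sum>t<n. w s * cnj (w t) * (a u s * a u t))"
    unfolding y_def cnj_sum sum_product by (intro sum.cong refl) (auto simp: a_def)
  also have "\<dots> = (\<Sum>s<n. \<Sum>t<n. \<Sum>u<?N. w s * cnj (w t) * (a u s * a u t))"
    by (subst sum.swap, rule sum.cong[OF refl], subst sum.swap) (rule refl)
  also have "\<dots> = (\<Sum>s<n. \<Sum>t<n. w s * cnj (w t) *
      (of_bool (s = t) * of_nat q + of_bool (side s = side t \<and> grp s \<noteq> grp t)))"
    unfolding sum_distrib_left[symmetric]
    by (intro sum.cong refl) (use grp_le in \<open>auto simp only: lessThan_iff sum_a_mult_a\<close>)
  also have "\<dots> = (\<Sum>s<n. (\<Sum>t<n. if s = t then w s * cnj (w s) * of_nat q else 0)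
      + w s * (\<Sum>t<n. of_bool (side s = side t \<and> grp s \<noteq> grp t) * cnj (w t)))"
    unfolding sum_distrib_left sum.distrib[symmetric]
    by (intro sum.cong refl) (auto simp: algebra_simps)
  also have "\<dots> = complex_of_real (q * (\<Sum>v<n. (cmod (w v))\<^sup>2))"
    unfolding cross by (simp add: sum_distrib_left mult_ac flip: complex_norm_square)
  finally have "(\<Sum>u<?N. (cmod (y u))\<^sup>2) = q * (\<Sum>v<n. (cmod (w v))\<^sup>2)"
    by (simp only: of_real_eq_iff)
  moreover have "(\<Sum>u<n. (cmod (y u))\<^sup>2) \<le> (\<Sum>u<?N. (cmod (y u))\<^sup>2)"
    using K_le by (intro sum_mono2 lessThan_subset_iff[THEN iffD2] mult_right_mono) auto
  ultimately show ?thesis by (simp add: y_def)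
qed

text \<open>An eigenvector for \<open>z \<noteq> 0\<close> lies in the image of \<open>d\<close>, so
  its class sums vanish by \<open>sum_cls_d\<close>. On it \<open>d\<close> acts as
  \<open>a\<close>, and \<open>sum_norm_a_mult_le\<close> applies.\<close>

lemma cmod_eigenvalue_d_le:
  assumes ev: "eigenvalue (mat n n (\<lambda>(u, v). d u v)) z"
  shows "cmod z \<le> sqrt q"
proof (cases "z = 0")
  case False
  obtain v where v: "v \<in> carrier_vec n" "v \<noteq> 0\<^sub>v n"
    "mat n n (\<lambda>(u, v). d u v) *\<^sub>v v = z \<cdot>\<^sub>v v"
    using ev by (auto simp: eigenvalue_def eigenvector_def)
  define w where "w i = v $ i" for i
  have eq: "(\<Sum>t<n. d u t * w t) = z * w u" if "u < n" for u
    using arg_cong[OF v(3), of "\<lambda>f. f $ u"] that v(1)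
    by (simp add: scalar_prod_def atLeast0LessThan w_def)
  have zero: "(\<Sum>u\<in>cls \<gamma> \<sigma>. w u) = 0" if "\<gamma> < K" for \<gamma> \<sigma>
  proof -
    have "z * (\<Sum>u\<in>cls \<gamma> \<sigma>. w u) = (\<Sum>u\<in>cls \<gamma> \<sigma>. \<Sum>t<n. d u t * w t)"
      using that by (auto simp: sum_distrib_left eq cls_def grp_less_iff intro!: sum.cong)
    also have "\<dots> = (\<Sum>t<n. (\<Sum>u\<in>cls \<gamma> \<sigma>. d u t) * w t)"
      by (subst sum.swap) (simp add: sum_distrib_right)
    also have "\<dots> = 0"
      using sum_cls_d[OF that] by simp
    finally show ?thesis using False by simp
  qed
  have "(\<Sum>t<n. a u t * w t) = z * w u" if "u < n" for u
    using eq[OF that] sum_x_mult_eq_zero[of w u] zero by (simp add: d_def algebra_simps sum_subtractf)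
  then have "(\<Sum>u<n. (cmod (z * w u))\<^sup>2) \<le> q * (\<Sum>v<n. (cmod (w v))\<^sup>2)"
    using sum_norm_a_mult_le[of w] zero by simp
  then have "(cmod z)\<^sup>2 * (\<Sum>v<n. (cmod (w v))\<^sup>2) \<le> q * (\<Sum>v<n. (cmod (w v))\<^sup>2)"
    by (simp add: norm_mult power_mult_distrib sum_distrib_left)
  moreover have "(\<Sum>v<n. (cmod (w v))\<^sup>2) > 0"
  proof -
    obtain i where "i < n" "w i \<noteq> 0"
      using v(1,2) unfolding w_def by (metis carrier_vecD eq_vecI index_zero_vec)
    then show ?thesis by (intro sum_pos2[of _ i]) auto
  qed
  ultimately have "(cmod z)\<^sup>2 \<le> q" by simp
  then show ?thesis by (rule real_le_rsqrt)
qed auto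

lemma mat_mult_eq:
  fixes f g :: "nat \<Rightarrow> nat \<Rightarrow> complex"
  shows "mat n n (\<lambda>(u, v). f u v) * mat n n (\<lambda>(u, v). g u v)
    = mat n n (\<lambda>(u, v). \<Sum>w<n. f u w * g w v)"
  by (rule eq_matI) (auto simp: scalar_prod_def atLeast0LessThan)

text \<open>The trace bound is used three times: for \<open>x0\<close>, \<open>x1\<close> and
  \<open>d\<close> the traces of the squares are \<open>2 * (K - 1)\<^sup>2\<close>,
  \<open>2 * (K - 1)\<close> and \<open>2 * K * (K - 1) * (r - 1)\<close>, and the moduli are at
  most \<open>K - 1\<close>, \<open>1\<close> and \<open>sqrt q\<close>.\<close>

theorem sum_cmod_eigenvalues_a_ge:
  "(\<Sum>z\<in>#proots (char_poly (mat n n (\<lambda>(u, v). a u v))). cmod z)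
    \<ge> 4 * real (K - 1) + 2 * real K * real (K - 1) * (real r - 1) / sqrt q"
proof -
  define M :: "(nat \<Rightarrow> nat \<Rightarrow> complex) \<Rightarrow> complex mat" where
    "M f = mat n n (\<lambda>(u, v). f u v)" for f
  have M: "M f \<in> carrier_mat n n" for f by (simp add: M_def)
  have M_mult: "M f * M g = M (\<lambda>u v. \<Sum>w<n. f u w * g w v)" for f g
    unfolding M_def by (rule mat_mult_eq)
  define E where "E A = (\<Sum>z\<in>#proots (char_poly A). cmod z)" for A
  have "M x * M d = 0\<^sub>m n n"
    unfolding M_mult unfolding M_def
    by (rule eq_matI) (auto intro!: sum_x_mult_eq_zero sum_cls_d)
  moreover have "M a = M x + M d"
    by (auto simp: M_def d_def)
  ultimately have "E (M a) = E (M x) + E (M d)"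
    using sum_cmod_eigenvalues_add[OF M M] by (simp add: E_def)
  moreover have "M x0 * M x1 = 0\<^sub>m n n"
    unfolding M_mult unfolding M_def by (rule eq_matI) (auto simp: sum_x0_mult_x1)
  moreover have "M x = M x0 + M x1"
    by (auto simp: M_def x_eq)
  ultimately have E_a: "E (M a) = E (M x0) + E (M x1) + E (M d)"
    using sum_cmod_eigenvalues_add[OF M M] by (simp add: E_def)
  have "E (M x0) \<ge> 2 * real (K - 1)"
  \<comment> \<open>For \<open>K = 1\<close> the modulus bound \<open>K - 1\<close> would be zero,
    and the trace bound divides by it.\<close>
  proof (cases "K = 1")
    case True
    have "E (M x0) \<ge> 0" unfolding E_def using sum_mset_mono[of _ "\<lambda>_. 0" cmod] by fastforce
    then show ?thesis using True by simp
  next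
    case False
    have cube: "M x0 * (M x0 * M x0) = (complex_of_real (real (K - 1)))\<^sup>2 \<cdot>\<^sub>m M x0"
      unfolding M_mult unfolding M_def
      by (rule eq_matI) (auto simp: sum_x0_mult_x0 sum_x0_mult_e0)
    have "(\<Sum>i<n. (M x0 * M x0) $$ (i, i)) = (\<Sum>i<n. complex_of_real (real ((K - 1)\<^sup>2) / real (K * r)))"
      unfolding M_mult unfolding M_def by (intro sum.cong refl) (auto simp: sum_x0_mult_x0 e0_def)
    then have "Re (\<Sum>i<n. (M x0 * M x0) $$ (i, i)) = 2 * (real (K - 1))\<^sup>2"
      using K_pos r_pos by simp
    then show ?thesis
      using sum_cmod_eigenvalues_ge[OF M, of "real (K - 1)" x0]
        cmod_eigenvalue_le_of_cube[OF M _ cube] False K_pos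
      by (simp add: E_def power2_eq_square)
  qed
  moreover have "E (M x1) \<ge> 2 * real (K - 1)"
  proof -
    have "M x1 * (M x1 * M x1) = M x1"
      unfolding M_mult unfolding M_def
      by (rule eq_matI) (auto simp: sum_x1_mult_x1 sum_x1_mult_e1)
    then have cube: "M x1 * (M x1 * M x1) = (complex_of_real 1)\<^sup>2 \<cdot>\<^sub>m M x1"
      by (auto simp: M_def)
    have "(\<Sum>i<n. (M x1 * M x1) $$ (i, i)) = (\<Sum>i<n. complex_of_real (1 / real r - 1 / real (K * r)))"
      unfolding M_mult unfolding M_def by (intro sum.cong refl) (auto simp: sum_x1_mult_x1 e1_def h_def)
    then have "Re (\<Sum>i<n. (M x1 * M x1) $$ (i, i)) = real n * (1 / real r - 1 / real (K * r))"
      by simp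
    also have "\<dots> = 2 * real (K - 1)"
      using K_pos r_pos by (simp add: field_simps of_nat_diff)
    finally have "Re (\<Sum>i<n. (M x1 * M x1) $$ (i, i)) = 2 * real (K - 1)" .
    then show ?thesis
      using sum_cmod_eigenvalues_ge[OF M, of 1 x1] cmod_eigenvalue_le_of_cube[OF M _ cube]
      by (simp add: E_def)
  qed
  moreover have "E (M d) \<ge> 2 * real K * real (K - 1) * (real r - 1) / sqrt q"
  proof -
    have "(\<Sum>i<n. (M d * M d) $$ (i, i)) = (\<Sum>i<n. complex_of_real (real (K - 1) - real (K - 1) / real r))"
      unfolding M_mult unfolding M_def by (intro sum.cong refl) (auto simp: sum_d_mult_d)
    then have "Re (\<Sum>i<n. (M d * M d) $$ (i, i)) = real n * (real (K - 1) - real (K - 1) / real r)"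
      by simp
    also have "\<dots> = 2 * real K * real (K - 1) * (real r - 1)"
      using r_pos by (simp add: field_simps)
    finally have "Re (\<Sum>i<n. (M d * M d) $$ (i, i)) = 2 * real K * real (K - 1) * (real r - 1)" .
    then show ?thesis
      using sum_cmod_eigenvalues_ge[OF M, of "sqrt q" d] cmod_eigenvalue_d_le q_eq
      by (simp add: E_def M_def)
  qed
  ultimately show ?thesis
    using E_a by (simp add: E_def M_def)
qed

end

section \<open>Comparison of the spectral estimate with the required bound\<close>

lemma energy_bound_arith:
  fixes k l :: nat
  assumes "k > 0" "k + l \<ge> 2"
  shows "(4 * real k + 2 * real (k + 1) * real k * (real (k + l) - 2) / sqrt (k + l))
      / (2 * real (k + 1) * (real (k + l) - 1))
    \<ge> (2 * real k + real l
        + sqrt (real k + real l) * ((real k)\<^sup>2 - (real l)\<^sup>2 + real l - real k - 2))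
      / ((real k + 1) * (real k + real l - 1))"
proof -
  define q where "q = real k + real l"
  define s where "s = sqrt q"
  have q: "q \<ge> 2" "real k = q - real l" "real (k + l) = q"
    using assms by (auto simp: q_def)
  have s: "s > 0" "s * s = q"
    using q by (auto simp: s_def)
  moreover have "s \<ge> 1"
    using q by (simp add: s_def)
  ultimately have "s \<le> q"
    using mult_left_mono[of 1 s s] by simp
  \<comment> \<open>This is the exact surplus of the spectral estimate after clearing the common
    denominators and multiplying by \<open>s\<close>, with \<open>k = q - l\<close> substituted; it
    vanishes for \<open>l = 0\<close>.\<close>
  have "0 \<le> (real l)\<^sup>2 * (q - 2) + real l * (q + 2 - s)"
    using q \<open>s \<le> q\<close> by auto
  also have "\<dots> = real (k + 1) * real k * (q - 2)
    - (real l * s + q * ((real k)\<^sup>2 - (real l)\<^sup>2 + real l - real k - 2))"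
    unfolding q of_nat_add of_nat_1 by (simp add: q(2) power2_eq_square algebra_simps)
  finally have "real l * s + s * s * ((real k)\<^sup>2 - (real l)\<^sup>2 + real l - real k - 2)
    \<le> real (k + 1) * real k * (q - 2)"
    using s by simp
  moreover have "x + s * y \<le> z / s" if "x * s + s * s * y \<le> z" for x y z
    using that s(1) by (simp add: pos_le_divide_eq algebra_simps)
  ultimately have "real l + s * ((real k)\<^sup>2 - (real l)\<^sup>2 + real l - real k - 2)
    \<le> real (k + 1) * real k * (q - 2) / s"
    by blast
  then have "2 * real k + real l + s * ((real k)\<^sup>2 - (real l)\<^sup>2 + real l - real k - 2)
    \<le> 2 * real k + real (k + 1) * real k * (q - 2) / s"
    by (simp only: add.assoc add_left_mono)
  also have "\<dots> = (4 * real k + 2 * real (k + 1) * real k * (q - 2) / s) / 2"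
    using s(1) by (simp add: field_simps)
  finally have "2 * real k + real l + s * ((real k)\<^sup>2 - (real l)\<^sup>2 + real l - real k - 2)
    \<le> (4 * real k + 2 * real (k + 1) * real k * (q - 2) / s) / 2" .
  then have "(2 * real k + real l + s * ((real k)\<^sup>2 - (real l)\<^sup>2 + real l - real k - 2))
      / ((real k + 1) * (q - 1))
    \<le> (4 * real k + 2 * real (k + 1) * real k * (q - 2) / s) / 2 / ((real k + 1) * (q - 1))"
    by (rule divide_right_mono) (use q in simp)
  then show ?thesis
    unfolding q(3) s_def[symmetric] q_def[symmetric]
    by (simp only: divide_divide_eq_left mult.assoc of_nat_add of_nat_1)
qed

section \<open>The regular graph and its energy\<close>

context elliptic_subdesign
begin

definition G :: "nat pair_pre_digraph" where
  "G = \<lparr>pverts = {..<n}, parcs = {(u, v). u < n \<and> v < n \<and> adj u v}\<rparr>"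

lemma regular_graph_G: "regular_graph (K - 1) G"
proof -
  have "out_degree (with_proj G) u = K - 1" if u: "u < n" for u
  proof -
    have "out_arcs (with_proj G) u = Pair u ` {v. v < n \<and> adj u v}"
      using u by (auto simp: out_arcs_def G_def)
    then have "complex_of_nat (out_degree (with_proj G) u) = of_nat (card {v. v < n \<and> adj u v})"
      by (simp add: out_degree_def card_image inj_on_def)
    also have "\<dots> = (\<Sum>v<n. a u v)"
      by (simp add: a_def of_bool_def Int_def flip: sum.inter_filter)
    also have "\<dots> = of_nat (K - 1)"
      using sum_a[of u K] grp_le[OF u] grp_less[OF u] K_le by simp
    finally show ?thesis by (simp only: of_nat_eq_iff)
  qed
  moreover have "pair_graph G"
  proof unfold_locales
    show "finite (parcs G)"
      by (rule finite_subset[of _ "{..<n} \<times> {..<n}"]) (auto simp: G_def)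
    show "symmetric (with_proj G)"
      by (auto simp: G_def symmetric_def adj_sym intro!: symI)
    show "fst e \<noteq> snd e" if "e \<in> parcs G" for e
      using that adj_side[of "fst e" "snd e"] by (auto simp: G_def)
  qed (auto simp: G_def)
  ultimately show ?thesis
    by (auto simp: regular_graph_def G_def)
qed

lemma energy_per_vertex_G_ge:
  "energy_per_vertex G \<ge>
    (4 * real (K - 1) + 2 * real K * real (K - 1) * (real r - 1) / sqrt q) / (2 * real K * real r)"
proof -
  \<comment> \<open>The sorted enumeration of an initial segment is the identity, so the adjacency
    matrix has exactly the entries of \<open>a\<close>, with no permutation of indices.\<close>
  have "sorted_list_of_set {..<n} = [0..<n]"
    by (simp add: lessThan_atLeast0)
  then have "adjacency_matrix G = mat n n (\<lambda>(u, v). a u v)"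
    by (auto simp: adjacency_matrix_def G_def a_def Let_def intro!: eq_matI)
  then show ?thesis
    using sum_cmod_eigenvalues_a_ge K_pos r_pos
    by (simp add: energy_per_vertex_def adjacency_eigenvalues_def G_def divide_right_mono)
qed

end

section \<open>Finite fields of prime power order\<close>

text \<open>The ring Z[z]. For roots of unity \<open>z\<close> of suitable order, finite fields
  arise as its quotients, represented by complex numbers.\<close>

definition int_adjoin :: "complex \<Rightarrow> complex set" where
  "int_adjoin z = range (\<lambda>f :: int poly. poly (map_poly of_int f) z)"

lemma int_adjoin_of_int: "of_int c \<in> int_adjoin z"
  unfolding int_adjoin_def by (rule range_eqI[of _ _ "[:c:]"]) (cases "c = 0"; simp add: map_poly_pCons)

lemma int_adjoin_0: "0 \<in> int_adjoin z" and int_adjoin_1: "1 \<in> int_adjoin z"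
  and int_adjoin_of_nat: "of_nat m \<in> int_adjoin z"
  using int_adjoin_of_int[of 0 z] int_adjoin_of_int[of 1 z] int_adjoin_of_int[of "int m" z] by simp_all

lemma int_adjoin_self: "z \<in> int_adjoin z"
  unfolding int_adjoin_def by (rule range_eqI[of _ _ "[:0, 1:]"]) simp

lemma int_adjoin_add: "x \<in> int_adjoin z \<Longrightarrow> y \<in> int_adjoin z \<Longrightarrow> x + y \<in> int_adjoin z"
  unfolding int_adjoin_def by (auto simp: image_iff) (metis of_int_hom.map_poly_hom_add poly_add)

lemma int_adjoin_mult: "x \<in> int_adjoin z \<Longrightarrow> y \<in> int_adjoin z \<Longrightarrow> x * y \<in> int_adjoin z"
  unfolding int_adjoin_def by (auto simp: image_iff) (metis of_int_poly_hom.hom_mult poly_mult)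

lemma int_adjoin_minus: "x \<in> int_adjoin z \<Longrightarrow> - x \<in> int_adjoin z"
  using int_adjoin_mult[OF int_adjoin_of_int[of "-1"]] by fastforce

lemma int_adjoin_diff: "x \<in> int_adjoin z \<Longrightarrow> y \<in> int_adjoin z \<Longrightarrow> x - y \<in> int_adjoin z"
  using int_adjoin_add[of x z "- y"] int_adjoin_minus by simp

lemma int_adjoin_power: "x \<in> int_adjoin z \<Longrightarrow> x ^ n \<in> int_adjoin z"
  by (induction n) (auto intro: int_adjoin_1 int_adjoin_mult)

lemma int_adjoin_sum: "(\<And>i. i \<in> I \<Longrightarrow> f i \<in> int_adjoin z) \<Longrightarrow> sum f I \<in> int_adjoin z"
  by (induction I rule: infinite_finite_induct) (auto intro: int_adjoin_0 int_adjoin_add)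

text \<open>Induction along Horner's scheme. The membership premises are carried along because
  congruences such as \<open>frobenius_add\<close> hold only for ring elements.\<close>

lemma int_adjoin_induct [consumes 1, case_names of_int self add mult]:
  assumes "x \<in> int_adjoin z"
    and "\<And>c. P (of_int c)" "P z"
    and "\<And>x y. x \<in> int_adjoin z \<Longrightarrow> y \<in> int_adjoin z \<Longrightarrow> P x \<Longrightarrow> P y \<Longrightarrow> P (x + y)"
    and "\<And>x y. x \<in> int_adjoin z \<Longrightarrow> y \<in> int_adjoin z \<Longrightarrow> P x \<Longrightarrow> P y \<Longrightarrow> P (x * y)"
  shows "P x"
proof -
  obtain f :: "int poly" where f: "x = poly (map_poly of_int f) z"
    using assms(1) by (auto simp: int_adjoin_def)
  have "poly (map_poly of_int f) z \<in> int_adjoin z \<and> P (poly (map_poly of_int f) z)"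
  proof (induction f)
    case 0
    then show ?case using assms(2)[of 0] int_adjoin_0 by simp
  next
    case (pCons c f)
    let ?y = "poly (map_poly of_int f) z"
    have "z * ?y \<in> int_adjoin z" "P (z * ?y)"
      using pCons(2) assms(3,5) by (auto intro: int_adjoin_mult int_adjoin_self)
    then have "of_int c + z * ?y \<in> int_adjoin z \<and> P (of_int c + z * ?y)"
      using assms(2,4) by (auto intro: int_adjoin_add int_adjoin_of_int)
    then show ?case
      using pCons(1) by (simp add: map_poly_pCons)
  qed
  then show ?thesis by (simp add: f)
qed

text \<open>Exponents are reduced modulo \<open>m\<close>. This finite generation over the integers
  is what lets multiplication by a ring element be written as an integer matrix.\<close>

lemma int_adjoin_root_of_unity_span:
  assumes "z ^ m = 1" "m > 0" "x \<in> int_adjoin z"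
  shows "\<exists>c. x = (\<Sum>i<m. of_int (c i) * z ^ i)"
proof -
  obtain f :: "int poly" where f: "x = poly (map_poly of_int f) z"
    using assms(3) by (auto simp: int_adjoin_def)
  have "x = (\<Sum>i\<le>degree f. of_int (coeff f i) * z ^ i)"
    unfolding f poly_altdef by (simp add: coeff_map_poly)
  also have "\<dots> = (\<Sum>j<m. \<Sum>i | i \<in> {..degree f} \<and> i mod m = j. of_int (coeff f i) * z ^ i)"
    by (rule sum.group[symmetric]) (use assms(2) in auto)
  also have "\<dots> = (\<Sum>j<m. of_int (\<Sum>i | i \<in> {..degree f} \<and> i mod m = j. coeff f i) * z ^ j)"
    unfolding of_int_sum sum_distrib_right
  proof (intro sum.cong refl)
    fix j i assume "i \<in> {i \<in> {..degree f}. i mod m = j}"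
    moreover have "z ^ i = z ^ (m * (i div m) + i mod m)" by simp
    ultimately show "of_int (coeff f i) * z ^ i = of_int (coeff f i) * z ^ j"
      unfolding power_add power_mult assms(1) by simp
  qed
  finally show ?thesis
    by (rule exI[of _ "\<lambda>j. \<Sum>i | i \<in> {..degree f} \<and> i mod m = j. coeff f i"])
qed

text \<open>\<open>1 / p\<close> would be an eigenvalue of the integer matrix of multiplication by \<open>1 / p\<close>.\<close>
lemma int_adjoin_root_of_unity_not_inverse:
  assumes z: "z ^ m = 1" "m > 0" and p: "p > (1::nat)" and x: "x \<in> int_adjoin z"
  shows "of_nat p * x \<noteq> 1"
proof
  assume px: "of_nat p * x = 1"
  have "\<exists>c. x * z ^ j = (\<Sum>i<m. of_int (c i) * z ^ i)" for j
    by (rule int_adjoin_root_of_unity_span[OF z]) (intro int_adjoin_mult int_adjoin_power int_adjoin_self x)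
  then obtain c where c: "\<And>j. x * z ^ j = (\<Sum>i<m. of_int (c j i) * z ^ i)"
    by metis
  define B :: "int mat" where "B = mat m m (\<lambda>(j, i). c j i)"
  \<comment> \<open>The powers of \<open>z\<close> may be linearly dependent, so \<open>B\<close> is
    just one choice of coefficients; the vector of these powers is an eigenvector of
    \<open>B\<close> for \<open>x\<close> in any case.\<close>
  define v where "v = vec m (\<lambda>i. z ^ i)"
  have B: "B \<in> carrier_mat m m" by (simp add: B_def)
  have "map_mat of_int B *\<^sub>v v = x \<cdot>\<^sub>v v"
    by (rule eq_vecI) (auto simp: B_def v_def scalar_prod_def atLeast0LessThan c)
  moreover have "v \<noteq> 0\<^sub>v m"
  proof
    assume "v = 0\<^sub>v m"
    then have "v $ 0 = 0" using z(2) by simp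
    then show False using z(2) by (simp add: v_def)
  qed
  ultimately have "eigenvalue (map_mat of_int B) x"
    using B by (auto simp: eigenvalue_def eigenvector_def v_def intro!: exI[of _ v])
  then have "poly (char_poly (map_mat of_int B)) x = 0"
    using eigenvalue_root_char_poly[of "map_mat of_int B" m x] B by simp
  then have "poly (map_poly of_int (char_poly B)) x = 0"
    using of_int_hom.char_poly_hom[OF B] by metis
  moreover have "lead_coeff (char_poly B) = 1"
    using degree_monic_char_poly[OF B] by simp
  ultimately have "algebraic_int x"
    unfolding algebraic_int_altdef_ipoly by blast
  moreover have "x = 1 / of_nat p"
    using px p by (auto simp: field_simps)
  ultimately have "x \<in> \<int>"
    by (intro rational_algebraic_int_is_int) auto
  then obtain t where "x = of_int t" by (elim Ints_cases)
  then have "of_int (int p * t) = (1 :: complex)" using px by simp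
  then have "int p * t = 1" by (simp only: of_int_eq_1_iff)
  then show False using p by (simp add: zmult_eq_1_iff)
qed

text \<open>From \<open>k * (p ^ n choose k) = p ^ n * (p ^ n - 1 choose (k - 1))\<close>: were the
  binomial coefficient prime to \<open>p\<close>, then \<open>p ^ n\<close> would divide the smaller
  number \<open>k\<close>.\<close>

lemma prime_dvd_prime_power_choose:
  fixes p n k :: nat
  assumes "prime p" "0 < k" "k < p ^ n"
  shows "p dvd (p ^ n choose k)"
proof (rule ccontr)
  assume "\<not> p dvd (p ^ n choose k)"
  then have "coprime (p ^ n) (p ^ n choose k)"
    using assms(1) by (simp add: prime_imp_coprime coprime_power_left_iff)
  moreover have "p ^ n dvd k * (p ^ n choose k)"
    using times_binomial_minus1_eq[OF assms(2), of "p ^ n"] by simp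
  ultimately have "p ^ n dvd k"
    by (simp add: coprime_dvd_mult_left_iff)
  with assms(2,3) show False by (simp add: nat_dvd_not_less)
qed

definition ideal_of :: "complex set \<Rightarrow> complex set \<Rightarrow> bool" where
  "ideal_of A I \<longleftrightarrow> I \<subseteq> A \<and> 0 \<in> I \<and> (\<forall>x\<in>I. \<forall>y\<in>I. x + y \<in> I) \<and> (\<forall>x\<in>A. \<forall>y\<in>I. x * y \<in> I)"

text \<open>The multiples of \<open>p\<close> form an ideal without \<open>1\<close>, because
  \<open>p\<close> is not invertible. Zorn's lemma gives a maximal ideal that contains
  \<open>p\<close> but not \<open>1\<close>, and maximality makes it prime.\<close>

lemma int_adjoin_prime_ideal_exists:
  assumes nonunit: "\<And>x. x \<in> int_adjoin z \<Longrightarrow> of_nat p * x \<noteq> 1"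
  obtains M where "ideal_of (int_adjoin z) M" "of_nat p \<in> M" "1 \<notin> M"
    "\<And>x y. x \<in> int_adjoin z \<Longrightarrow> y \<in> int_adjoin z \<Longrightarrow> x * y \<in> M \<Longrightarrow> x \<in> M \<or> y \<in> M"
proof -
  let ?A = "int_adjoin z"
  define \<A> where "\<A> = {I. ideal_of ?A I \<and> of_nat p \<in> I \<and> 1 \<notin> I}"
  have "(\<lambda>x. of_nat p * x) ` ?A \<in> \<A>"
    unfolding \<A>_def ideal_of_def mem_Collect_eq
  proof (intro conjI ballI)
    fix x y assume "x \<in> (\<lambda>x. of_nat p * x) ` ?A" "y \<in> (\<lambda>x. of_nat p * x) ` ?A"
    then show "x + y \<in> (\<lambda>x. of_nat p * x) ` ?A"
      by (auto simp flip: distrib_left intro!: imageI int_adjoin_add)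
  next
    fix x y assume "x \<in> ?A" "y \<in> (\<lambda>x. of_nat p * x) ` ?A"
    then show "x * y \<in> (\<lambda>x. of_nat p * x) ` ?A"
      by (auto simp: mult.left_commute[of x] intro!: imageI int_adjoin_mult)
  next
    show "0 \<in> (\<lambda>x. of_nat p * x) ` ?A"
      by (rule image_eqI[of _ _ 0]) (auto intro: int_adjoin_0)
    show "of_nat p \<in> (\<lambda>x. of_nat p * x) ` ?A"
      by (rule image_eqI[of _ _ 1]) (auto intro: int_adjoin_1)
  qed (auto dest: nonunit simp: eq_commute[of 1] intro: int_adjoin_mult int_adjoin_of_nat)
  moreover have "\<Union>\<C> \<in> \<A>" if "\<C> \<noteq> {}" "subset.chain \<A> \<C>" for \<C>
  proof -
    have sub: "\<And>I. I \<in> \<C> \<Longrightarrow> ideal_of ?A I \<and> of_nat p \<in> I \<and> 1 \<notin> I"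
      using that(2) by (auto simp: subset.chain_def \<A>_def)
    define U where "U = \<Union>\<C>"
    have "x + y \<in> U" if xy: "x \<in> U" "y \<in> U" for x y
    proof -
      obtain I J where IJ: "I \<in> \<C>" "J \<in> \<C>" "x \<in> I" "y \<in> J"
        using xy unfolding U_def by blast
      then have "I \<subseteq> J \<or> J \<subseteq> I"
        using \<open>subset.chain \<A> \<C>\<close> unfolding subset.chain_def by blast
      then obtain L where "L \<in> \<C>" "x \<in> L" "y \<in> L"
        using IJ by blast
      then show ?thesis
        using sub[of L] by (auto simp: U_def ideal_of_def)
    qed
    moreover have "U \<subseteq> ?A" "1 \<notin> U"
      using sub unfolding ideal_of_def U_def by blast+
    moreover have "x * y \<in> U" if "x \<in> ?A" "y \<in> U" for x y
      using that sub unfolding ideal_of_def U_def by blast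
    moreover have "0 \<in> U" "of_nat p \<in> U"
      using sub \<open>\<C> \<noteq> {}\<close> unfolding ideal_of_def U_def by blast+
    ultimately have "U \<in> \<A>"
      unfolding \<A>_def ideal_of_def by blast
    then show ?thesis by (simp add: U_def)
  qed
  ultimately obtain M where M: "M \<in> \<A>" and max: "\<And>I. I \<in> \<A> \<Longrightarrow> M \<subseteq> I \<Longrightarrow> I = M"
    using subset_Zorn_nonempty[of \<A>] by blast
  have id: "M \<subseteq> ?A" "0 \<in> M" "of_nat p \<in> M" "1 \<notin> M"
    and add: "\<And>x y. x \<in> M \<Longrightarrow> y \<in> M \<Longrightarrow> x + y \<in> M"
    and mult: "\<And>x y. x \<in> ?A \<Longrightarrow> y \<in> M \<Longrightarrow> x * y \<in> M"
    using M by (auto simp: \<A>_def ideal_of_def)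
  have "y \<in> M" if xy: "x \<in> ?A" "y \<in> ?A" "x * y \<in> M" "x \<notin> M" for x y
  proof -
    \<comment> \<open>This ideal is strictly larger than \<open>M\<close>, so it contains
      \<open>1\<close>; multiplying \<open>1 = m + t * x\<close> by \<open>y\<close> then puts
      \<open>y\<close> into \<open>M\<close>.\<close>
    define I where "I = {m + t * x | m t. m \<in> M \<and> t \<in> ?A}"
    have sub: "M \<subseteq> I"
      unfolding I_def using int_adjoin_0 by force
    have "x \<in> I"
      unfolding I_def using id(2) int_adjoin_1 by force
    have "I \<subseteq> ?A"
      using id(1) xy(1) by (auto simp: I_def intro!: int_adjoin_add int_adjoin_mult)
    moreover have "u + v \<in> I" if uv: "u \<in> I" "v \<in> I" for u v
    proof -
      obtain m t m' t' where "u = m + t * x" "v = m' + t' * x" "m \<in> M" "m' \<in> M" "t \<in> ?A" "t' \<in> ?A"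
        using uv by (auto simp: I_def)
      moreover from this have "u + v = (m + m') + (t + t') * x"
        by (simp add: algebra_simps)
      ultimately show ?thesis
        unfolding I_def using add int_adjoin_add by blast
    qed
    moreover have "u * v \<in> I" if uv: "u \<in> ?A" "v \<in> I" for u v
    proof -
      obtain m t where "v = m + t * x" "m \<in> M" "t \<in> ?A"
        using uv by (auto simp: I_def)
      moreover from this have "u * v = u * m + (u * t) * x"
        by (simp add: algebra_simps)
      ultimately show ?thesis
        unfolding I_def using mult int_adjoin_mult uv(1) by blast
    qed
    ultimately have "ideal_of ?A I"
      using sub id(2) by (auto simp: ideal_of_def)
    moreover have "I \<noteq> M" using \<open>x \<in> I\<close> xy(4) by blast
    ultimately have "1 \<in> I"
      using max[OF _ sub] sub id(3) by (auto simp: \<A>_def)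
    then obtain m t where "1 = m + t * x" "m \<in> M" "t \<in> ?A"
      by (auto simp: I_def)
    then have "y = y * m + t * (x * y)"
      by (metis distrib_right mult.assoc mult.commute mult_1)
    then show ?thesis
      using add mult xy \<open>m \<in> M\<close> \<open>t \<in> ?A\<close> by metis
  qed
  then show ?thesis
    using that[of M] M by (auto simp: \<A>_def)
qed

text \<open>
  The residue field \<open>\<int>[z] / M\<close> for a primitive \<open>(p\<^sup>e - 1)\<close>-th root of unity \<open>z\<close>. By the Frobenius map every
  residue \<open>x\<close> satisfies \<open>x\<^sup>q = x\<close> with \<open>q = p\<^sup>e\<close>, so that \<open>0\<close> and the powers of \<open>z\<close> are a full set of
  representatives; they are distinct because a non-trivial power \<open>w\<close> of \<open>z\<close> has \<open>\<Sum>t<q - 1. w\<^sup>t = 0\<close>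
  whereas \<open>w = 1\<close> modulo \<open>M\<close> would make this sum \<open>-1\<close>.
\<close>
locale cyclotomic_residue_field =
  fixes p e m :: nat and z :: complex and M :: "complex set"
  assumes p: "prime p" and e: "e > 0" and m: "p ^ e = m + 1"
    and z: "z ^ m = 1" and z_primitive: "\<And>i. 0 < i \<Longrightarrow> i < m \<Longrightarrow> z ^ i \<noteq> 1"
    and ideal: "ideal_of (int_adjoin z) M" and p_in_M: "of_nat p \<in> M" and one_notin_M: "1 \<notin> M"
    and prime_ideal: "\<And>x y. x \<in> int_adjoin z \<Longrightarrow> y \<in> int_adjoin z \<Longrightarrow> x * y \<in> M \<Longrightarrow> x \<in> M \<or> y \<in> M"
begin

lemma m_pos: "m > 0"
  using one_less_power[OF prime_gt_1_nat[OF p] e] m by simp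

lemma M_0: "0 \<in> M"
  and M_add: "x \<in> M \<Longrightarrow> y \<in> M \<Longrightarrow> x + y \<in> M"
  and M_mult: "x \<in> int_adjoin z \<Longrightarrow> y \<in> M \<Longrightarrow> x * y \<in> M"
  using ideal by (auto simp: ideal_of_def)

lemma M_minus: "x \<in> M \<Longrightarrow> - x \<in> M"
  using M_mult[OF int_adjoin_of_int[of "-1"]] by fastforce

lemma M_diff: "x \<in> M \<Longrightarrow> y \<in> M \<Longrightarrow> x - y \<in> M"
  using M_add[of x "- y"] M_minus by simp

lemma M_sum: "(\<And>i. i \<in> I \<Longrightarrow> f i \<in> M) \<Longrightarrow> sum f I \<in> M"
  by (induction I rule: infinite_finite_induct) (auto intro: M_0 M_add)

lemma frobenius_add:
  assumes x: "x \<in> int_adjoin z" and y: "y \<in> int_adjoin z"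
  shows "(x + y) ^ (p ^ e) - x ^ (p ^ e) - y ^ (p ^ e) \<in> M"
proof -
  let ?q = "p ^ e"
  let ?f = "\<lambda>k. of_nat (?q choose k) * x ^ k * y ^ (?q - k)"
  have q: "?q > 0" using p by (simp add: prime_gt_0_nat)
  have "(x + y) ^ ?q = (\<Sum>k\<le>?q. ?f k)"
    by (rule binomial_ring)
  also have "{..?q} = insert 0 (insert ?q {0<..<?q})"
    using q by auto
  also have "sum ?f \<dots> = y ^ ?q + x ^ ?q + sum ?f {0<..<?q}"
    using q by simp
  finally have "(x + y) ^ ?q - x ^ ?q - y ^ ?q = sum ?f {0<..<?q}"
    by simp
  also have "\<dots> \<in> M"
  proof (rule M_sum)
    fix k assume "k \<in> {0<..<?q}"
    then obtain c where c: "?q choose k = p * c"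
      using prime_dvd_prime_power_choose[OF p, of k e] by auto
    have "(of_nat c * x ^ k * y ^ (?q - k)) * of_nat p \<in> M"
      by (intro M_mult int_adjoin_mult int_adjoin_power x y p_in_M int_adjoin_of_nat)
    then show "?f k \<in> M"
      unfolding c by (simp add: mult_ac)
  qed
  finally show ?thesis .
qed

text \<open>Modulo \<open>M\<close>, raising to the power \<open>p ^ e\<close> respects sums and
  products, so its fixed elements are closed under both; they include \<open>z\<close> because
  \<open>z ^ m = 1\<close>.\<close>

lemma fermat: "x \<in> int_adjoin z \<Longrightarrow> x ^ (p ^ e) - x \<in> M"
proof (induction rule: int_adjoin_induct)
  case (add x y)
  have "((x + y) ^ (p ^ e) - x ^ (p ^ e) - y ^ (p ^ e)) + (x ^ (p ^ e) - x) + (y ^ (p ^ e) - y) \<in> M"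
    using add frobenius_add by (intro M_add)
  then show ?case by (simp add: algebra_simps)
next
  case (mult x y)
  have "x ^ (p ^ e) * (y ^ (p ^ e) - y) + y * (x ^ (p ^ e) - x) \<in> M"
    using mult by (intro M_add M_mult int_adjoin_power)
  then show ?case by (simp add: algebra_simps power_mult_distrib)
next
  case self
  then show ?case using z M_0 by (simp add: m)
next
  case (of_int c)
  have nat: "of_nat k ^ (p ^ e) - of_nat k \<in> M" for k
  proof (induction k)
    case 0
    then show ?case using M_0 p by (simp add: power_0_left prime_gt_0_nat)
  next
    case (Suc k)
    have "((of_nat k + 1) ^ (p ^ e) - of_nat k ^ (p ^ e) - 1 ^ (p ^ e)) + (of_nat k ^ (p ^ e) - of_nat k) \<in> M"
      using Suc by (intro M_add frobenius_add int_adjoin_of_nat int_adjoin_1)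
    then show ?case by (simp add: algebra_simps)
  qed
  show ?case
  proof (cases c rule: int_cases2)
    case (nonneg k)
    then show ?thesis using nat by simp
  next
    case (nonpos k)
    let ?k = "of_nat k :: complex"
    \<comment> \<open>Additivity applied to \<open>?k + - ?k = 0\<close> handles negative integers
      without a case distinction on the parity of \<open>p\<close>.\<close>
    have "- ((?k + - ?k) ^ (p ^ e) - ?k ^ (p ^ e) - (- ?k) ^ (p ^ e)) - (?k ^ (p ^ e) - ?k) \<in> M"
      by (rule M_diff[OF M_minus[OF frobenius_add] nat])
        (auto intro: int_adjoin_of_nat int_adjoin_minus)
    moreover have "(0 :: complex) ^ (p ^ e) = 0" using p by (simp add: power_0_left prime_gt_0_nat)
    ultimately show ?thesis using nonpos by simp
  qed
qed

lemma inj_on_z_power: "inj_on (\<lambda>i. z ^ i) {..<m}"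
proof (rule linorder_inj_onI)
  fix i j assume ij: "i < j" "i \<in> {..<m}" "j \<in> {..<m}"
  have "z \<noteq> 0" using z m_pos by (auto simp: power_0_left)
  moreover have "z ^ j = z ^ i * z ^ (j - i)" using ij by (simp flip: power_add)
  ultimately show "z ^ i \<noteq> z ^ j" using z_primitive[of "j - i"] ij by auto
qed auto

lemma power_m_eq_prod: "x ^ m - 1 = (\<Prod>i<m. x - z ^ i)"
proof -
  have "monom 1 m - 1 = (\<Prod>i<m. [:- (z ^ i), 1:])"
  proof (rule poly_eqI_degree_lead_coeff[where n = m and A = "(\<lambda>i. z ^ i) ` {..<m}"])
    have deg: "degree (\<Prod>i<m. [:- (z ^ i), 1:]) = m"
      by (subst degree_prod_eq_sum_degree) auto
    then show "degree (\<Prod>i<m. [:- (z ^ i), 1:]) \<le> m" by simp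
    have "lead_coeff (\<Prod>i<m. [:- (z ^ i), 1:]) = 1"
      by (simp add: lead_coeff_prod)
    then show "coeff (monom 1 m - 1) m = coeff (\<Prod>i<m. [:- (z ^ i), 1:]) m"
      using m_pos by (simp add: deg)
    show "m \<le> card ((\<lambda>i. z ^ i) ` {..<m})"
      by (simp add: card_image inj_on_z_power)
    show "degree (monom 1 m - 1 :: complex poly) \<le> m"
      by (intro degree_diff_le degree_monom_le) auto
    fix w assume "w \<in> (\<lambda>i. z ^ i) ` {..<m}"
    then obtain i where i: "i < m" "w = z ^ i" by auto
    have "w ^ m = (z ^ m) ^ i" by (simp add: i(2) mult.commute flip: power_mult)
    then show "poly (monom 1 m - 1) w = poly (\<Prod>i<m. [:- (z ^ i), 1:]) w"
      using i by (auto simp: poly_monom poly_prod z intro!: prod_zero[symmetric])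
  qed
  from arg_cong[OF this, of "\<lambda>f. poly f x"] show ?thesis
    by (simp add: poly_monom poly_prod)
qed

definition F :: "complex set" where
  "F = insert 0 ((\<lambda>i. z ^ i) ` {..<m})"

lemma F_subset: "x \<in> F \<Longrightarrow> x \<in> int_adjoin z"
  by (auto simp: F_def intro: int_adjoin_0 int_adjoin_power int_adjoin_self)

lemma z_power_in_F: "z ^ i \<in> F"
proof -
  have "z ^ i = z ^ (m * (i div m) + i mod m)" by simp
  also have "\<dots> = z ^ (i mod m)" unfolding power_add power_mult z by simp
  finally show ?thesis using m_pos by (auto simp: F_def)
qed

text \<open>Here \<open>x ^ (p ^ e) - x\<close> is the product of \<open>x\<close> and all
  \<open>x - z ^ i\<close> with \<open>i < m\<close>. It lies in the prime ideal \<open>M\<close>,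
  hence so does one of the factors.\<close>

lemma representative_exists:
  assumes x: "x \<in> int_adjoin z"
  shows "\<exists>y\<in>F. x - y \<in> M"
proof -
  have "(\<Prod>i\<in>I. x - z ^ i) \<in> M \<Longrightarrow> \<exists>i\<in>I. x - z ^ i \<in> M" if "finite I" for I
    using that
  proof (induction I)
    case empty
    then show ?case using one_notin_M by simp
  next
    case (insert i I)
    have "(\<Prod>i\<in>I. x - z ^ i) \<in> int_adjoin z"
      by (induction I rule: infinite_finite_induct)
        (auto intro: int_adjoin_1 int_adjoin_mult int_adjoin_diff x int_adjoin_power int_adjoin_self)
    then show ?case
      using insert prime_ideal[of "x - z ^ i" "\<Prod>i\<in>I. x - z ^ i"]
      by (auto intro: int_adjoin_diff x int_adjoin_power int_adjoin_self)
  qed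
  moreover have "x ^ (p ^ e) - x = x * (x ^ m - 1)"
    by (simp add: m algebra_simps)
  then have "x \<in> M \<or> x ^ m - 1 \<in> M"
    using fermat[OF x] prime_ideal[of x "x ^ m - 1"] x
    by (simp add: int_adjoin_diff int_adjoin_power int_adjoin_1)
  ultimately show ?thesis
    unfolding power_m_eq_prod by (auto simp: F_def)
qed

lemma z_power_diff_notin_M:
  assumes "i < j" "j < m"
  shows "z ^ j - z ^ i \<notin> M"
proof
  assume *: "z ^ j - z ^ i \<in> M"
  define w where "w = z ^ (j - i)"
  have w: "w \<in> int_adjoin z" by (simp add: w_def int_adjoin_power int_adjoin_self)
  have "z ^ (m - i) * (z ^ j - z ^ i) \<in> M"
    using * by (intro M_mult int_adjoin_power int_adjoin_self)
  also have "z ^ (m - i) * (z ^ j - z ^ i) = z ^ m * z ^ (j - i) - z ^ m"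
    using assms by (simp add: algebra_simps flip: power_add)
  finally have "w - 1 \<in> M" by (simp add: z w_def)
  moreover have w_power: "w ^ t - 1 = (\<Sum>i<t. w ^ i) * (w - 1)" for t
    using power_diff_1_eq[of w t] by (simp add: mult.commute)
  ultimately have "w ^ t - 1 \<in> M" for t
    using w by (auto intro!: M_mult int_adjoin_sum int_adjoin_power)
  then have "(\<Sum>t<m. w ^ t - 1) \<in> M" by (rule M_sum)
  moreover have "(\<Sum>t<m. w ^ t) = 0"
  proof -
    have "w \<noteq> 1" using assms z_primitive[of "j - i"] by (simp add: w_def)
    moreover have "w ^ m = (z ^ m) ^ (j - i)"
      by (simp add: w_def mult.commute flip: power_mult)
    ultimately show ?thesis using w_power[of m] z by simp
  qed
  ultimately have "- of_nat m \<in> M" by (simp add: sum_subtractf)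
  \<comment> \<open>As \<open>m + 1 = p ^ e\<close> is a multiple of \<open>p\<close>, having
    \<open>- m\<close> in \<open>M\<close> as well would force \<open>1\<close> into
    \<open>M\<close>.\<close>
  moreover have "of_nat (m + 1) \<in> M"
  proof -
    have "of_nat (p ^ (e - 1)) * of_nat p \<in> M"
      by (intro M_mult int_adjoin_of_nat p_in_M)
    also have "of_nat (p ^ (e - 1)) * of_nat p = (of_nat (p ^ e) :: complex)"
      using e by (cases e) auto
    finally show ?thesis by (simp only: m)
  qed
  ultimately have "- of_nat m + of_nat (m + 1) \<in> M" by (rule M_add)
  then show False using one_notin_M by simp
qed

lemma z_power_notin_M: "z ^ i \<notin> M"
proof
  assume "z ^ i \<in> M"
  then have "(z ^ i) ^ (m - 1) * z ^ i \<in> M"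
    by (intro M_mult int_adjoin_power int_adjoin_self)
  also have "(z ^ i) ^ (m - 1) * z ^ i = (z ^ i) ^ m"
    using m_pos by (rule power_minus_mult)
  also have "\<dots> = (z ^ m) ^ i" by (simp add: mult.commute flip: power_mult)
  finally show False using z one_notin_M by simp
qed

lemma representative_unique:
  assumes "x \<in> F" "y \<in> F" "x - y \<in> M"
  shows "x = y"
proof -
  have "i = j" if "z ^ i - z ^ j \<in> M" "i < m" "j < m" for i j
    using that z_power_diff_notin_M[of i j] z_power_diff_notin_M[of j i] M_minus[OF that(1)]
    by (cases i j rule: linorder_cases) auto
  then show ?thesis
    using assms z_power_notin_M M_minus[OF assms(3)] by (auto simp: F_def)
qed

definition rep :: "complex \<Rightarrow> complex" where
  "rep x = (THE y. y \<in> F \<and> x - y \<in> M)"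

lemma rep: "x \<in> int_adjoin z \<Longrightarrow> rep x \<in> F" "x \<in> int_adjoin z \<Longrightarrow> x - rep x \<in> M"
proof -
  assume "x \<in> int_adjoin z"
  then obtain y where y: "y \<in> F" "x - y \<in> M" using representative_exists by blast
  have "rep x = y"
    unfolding rep_def
  proof (rule the_equality)
    fix y' assume "y' \<in> F \<and> x - y' \<in> M"
    then show "y' = y"
      using y M_diff[of "x - y" "x - y'"] by (intro representative_unique) auto
  qed (use y in auto)
  then show "rep x \<in> F" "x - rep x \<in> M" using y by auto
qed

lemma rep_eqI:
  assumes "x \<in> int_adjoin z" "y \<in> F" "x - y \<in> M"
  shows "rep x = y"
  using rep[OF assms(1)] M_diff[OF assms(3) rep(2)[OF assms(1)]] assms(2)
  by (intro representative_unique) auto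

lemma rep_eq_repI:
  assumes "x \<in> int_adjoin z" "y \<in> int_adjoin z" "x - y \<in> M"
  shows "rep x = rep y"
  using rep[OF assms(2)] M_add[OF assms(3) rep(2)[OF assms(2)]] assms(1)
  by (intro rep_eqI) auto

text \<open>The representatives, zero and the powers of \<open>z\<close>, are closed under complex
  multiplication, so only addition has to be reduced. Using representatives instead of cosets keeps
  the carrier inside the complex numbers.\<close>

definition R :: "complex ring" where
  "R = \<lparr>carrier = F, mult = (*), one = 1, zero = 0, add = (\<lambda>x y. rep (x + y))\<rparr>"

lemma F_mult:
  assumes "x \<in> F" "y \<in> F"
  shows "x * y \<in> F"
proof -
  have *: "w = 0 \<or> (\<exists>i. w = z ^ i)" if "w \<in> F" for w
    using that by (auto simp: F_def)
  have "0 \<in> F" by (simp add: F_def)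
  then show ?thesis
    using *[OF assms(1)] *[OF assms(2)] by (auto simp: z_power_in_F simp flip: power_add)
qed

lemma R_field: "field R"
proof -
  note F_add = int_adjoin_add[OF F_subset F_subset]
  have "1 \<in> F" using z_power_in_F[of 0] by simp
  have "0 \<in> F" by (simp add: F_def)
  have "abelian_group R"
  proof (rule abelian_groupI)
    fix x y w assume "x \<in> carrier R" "y \<in> carrier R" "w \<in> carrier R"
    then have xyw: "x \<in> F" "y \<in> F" "w \<in> F" by (auto simp: R_def)
    have "rep (x + y) \<in> int_adjoin z" "rep (y + w) \<in> int_adjoin z"
      using xyw by (auto intro: F_subset[OF rep(1)[OF F_add]])
    have "rep (rep (x + y) + w) = rep (x + rep (y + w))"
    proof (rule rep_eq_repI)
      have "(y + w - rep (y + w)) - (x + y - rep (x + y)) \<in> M"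
        by (rule M_diff[OF rep(2)[OF F_add] rep(2)[OF F_add]]) (use xyw in auto)
      then show "rep (x + y) + w - (x + rep (y + w)) \<in> M"
        by (simp add: algebra_simps)
    qed (use xyw \<open>rep (x + y) \<in> int_adjoin z\<close> \<open>rep (y + w) \<in> int_adjoin z\<close>
      in \<open>auto intro: int_adjoin_add F_subset\<close>)
    then show "(x \<oplus>\<^bsub>R\<^esub> y) \<oplus>\<^bsub>R\<^esub> w = x \<oplus>\<^bsub>R\<^esub> (y \<oplus>\<^bsub>R\<^esub> w)"
      by (simp add: R_def)
  next
    fix x assume "x \<in> carrier R"
    then have x: "x \<in> F" by (simp add: R_def)
    then have "rep x = x"
      using M_0 by (intro rep_eqI) (auto intro: F_subset)
    then show "\<zero>\<^bsub>R\<^esub> \<oplus>\<^bsub>R\<^esub> x = x" by (simp add: R_def)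
    have mx: "- x \<in> int_adjoin z" using x by (intro int_adjoin_minus F_subset)
    have "rep (rep (- x) + x) = 0"
    proof (rule rep_eqI)
      show "rep (- x) + x \<in> int_adjoin z"
        by (rule int_adjoin_add[OF F_subset[OF rep(1)[OF mx]] F_subset[OF x]])
      show "rep (- x) + x - 0 \<in> M"
        using M_minus[OF rep(2)[OF mx]] by (simp add: algebra_simps)
    qed (rule \<open>0 \<in> F\<close>)
    then show "\<exists>y\<in>carrier R. y \<oplus>\<^bsub>R\<^esub> x = \<zero>\<^bsub>R\<^esub>"
      using rep(1)[OF mx] by (auto simp: R_def)
  qed (auto simp: R_def \<open>0 \<in> F\<close> add.commute intro: rep(1) F_add)
  moreover have "comm_monoid R"
    by (rule comm_monoidI) (auto simp: R_def F_mult \<open>1 \<in> F\<close> mult_ac)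
  ultimately have "cring R"
  proof (rule cringI)
    fix x y w assume "x \<in> carrier R" "y \<in> carrier R" "w \<in> carrier R"
    then have xyw: "x \<in> F" "y \<in> F" "w \<in> F" by (auto simp: R_def)
    have "rep (x * w + y * w) = rep (x + y) * w"
    proof (rule rep_eqI)
      have "w * (x + y - rep (x + y)) \<in> M"
        using xyw by (intro M_mult[OF F_subset rep(2)] F_add)
      then show "x * w + y * w - rep (x + y) * w \<in> M"
        by (simp add: algebra_simps)
    qed (use xyw in \<open>auto intro!: F_add F_mult rep(1)\<close>)
    then show "(x \<oplus>\<^bsub>R\<^esub> y) \<otimes>\<^bsub>R\<^esub> w = x \<otimes>\<^bsub>R\<^esub> w \<oplus>\<^bsub>R\<^esub> y \<otimes>\<^bsub>R\<^esub> w"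
      by (simp add: R_def)
  qed
  then show ?thesis
  proof (rule cring.cring_fieldI2)
    fix x assume "x \<in> carrier R" "x \<noteq> \<zero>\<^bsub>R\<^esub>"
    then obtain i where "i < m" "x = z ^ i" by (auto simp: R_def F_def)
    then have "x * z ^ (m - i) = 1" by (simp add: z flip: power_add)
    then show "\<exists>y\<in>carrier R. x \<otimes>\<^bsub>R\<^esub> y = \<one>\<^bsub>R\<^esub>"
      using z_power_in_F by (auto simp: R_def)
  qed (simp add: R_def)
qed

lemma card_R: "card (carrier R) = p ^ e"
proof -
  have "0 \<notin> (\<lambda>i. z ^ i) ` {..<m}" using z_power_notin_M M_0 by (metis imageE)
  then show ?thesis
    by (simp add: R_def F_def card_image inj_on_z_power m)
qed

end

theorem finite_field_exists:
  assumes "primepow (q::nat)"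
  shows "\<exists>R :: complex ring. field R \<and> card (carrier R) = q"
proof -
  obtain p e where pe: "prime p" "e > 0" "q = p ^ e"
    using assms by (auto simp: primepow_def)
  define m where "m = q - 1"
  have "q > 1" using primepow_gt_Suc_0[OF assms] by simp
  then have m: "q = m + 1" "m > 0" by (auto simp: m_def)
  define z where "z = cis (2 * pi / real m)"
  have z_power: "z ^ i = cis (2 * pi * real i / real m)" for i
    by (simp add: z_def DeMoivre mult_ac)
  have z: "z ^ m = 1"
    using m(2) by (simp add: z_power)
  have primitive: "z ^ i \<noteq> 1" if "0 < i" "i < m" for i
  proof
    assume "z ^ i = 1"
    then have "z ^ i = z ^ 0" by simp
    moreover have "inj_on (\<lambda>k. cis (2 * pi * real k / real m)) {..<m}"
      using bij_betw_roots_unity[OF m(2)] by (simp add: bij_betw_def)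
    ultimately have "i = 0"
      using that unfolding z_power by (auto dest: inj_onD[of _ _ i 0])
    with that show False by simp
  qed
  obtain M where M: "ideal_of (int_adjoin z) M" "of_nat p \<in> M" "1 \<notin> M"
    "\<And>x y. x \<in> int_adjoin z \<Longrightarrow> y \<in> int_adjoin z \<Longrightarrow> x * y \<in> M \<Longrightarrow> x \<in> M \<or> y \<in> M"
    using int_adjoin_prime_ideal_exists[OF int_adjoin_root_of_unity_not_inverse[OF z m(2), of p]]
      prime_gt_1_nat[OF pe(1)] by metis
  interpret cyclotomic_residue_field p e m z M
    by unfold_locales (use pe m z primitive M in auto)
  show ?thesis
    using R_field card_R pe(3) by blast
qed

section \<open>The punctured affine plane over a finite field\<close>

context field
begin

text \<open>
  \<open>(Some s, a)\<close> encodes the vector \<open>a (1, s)\<close> and \<open>(None, a)\<close> the vector \<open>a (0, 1)\<close>; incidence of a point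
  \<open>u\<close> with a line \<open>v\<close> is \<open>det (u, v) = 1\<close>, up to a harmless sign change on the vectors \<open>(None, a)\<close>.
\<close>
definition incident :: "'a option \<Rightarrow> 'a \<Rightarrow> 'a option \<Rightarrow> 'a \<Rightarrow> bool" where
  "incident i a j b = (case (i, j) of
      (Some s, Some t) \<Rightarrow> b \<otimes> (a \<otimes> (t \<ominus> s)) = \<one>
    | (None, None) \<Rightarrow> False
    | _ \<Rightarrow> b \<otimes> a = \<one>)"

definition proj_line :: "'a option set" where
  "proj_line = insert None (Some ` carrier R)"

definition units :: "'a set" where
  "units = carrier R - {\<zero>}"

lemma ex1_unit_inverse:
  assumes "x \<in> units"
  shows "\<exists>!b. b \<in> units \<and> b \<otimes> x = \<one>"
proof (rule ex1I)
  show "inv x \<in> units \<and> inv x \<otimes> x = \<one>"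
    using assms field_Units by (auto simp: units_def)
next
  fix b assume "b \<in> units \<and> b \<otimes> x = \<one>"
  then show "b = inv x"
    using assms comm_inv_char[of x b] m_comm[of b x] by (auto simp: units_def)
qed

lemma mult_eq_oneD:
  assumes "b \<otimes> x = \<one>" "b \<otimes> y = \<one>" "b \<in> carrier R" "x \<in> carrier R" "y \<in> carrier R"
  shows "x = y"
proof -
  have "x = x \<otimes> (b \<otimes> y)" using assms by simp
  also have "\<dots> = (b \<otimes> x) \<otimes> y" using assms(3-5) by (simp add: m_ac)
  also have "\<dots> = y" using assms by simp
  finally show ?thesis .
qed

lemma mult_units: "x \<in> units \<Longrightarrow> y \<in> units \<Longrightarrow> x \<otimes> y \<in> units"
  by (auto simp: units_def integral_iff)

lemma minus_units: "s \<in> carrier R \<Longrightarrow> t \<in> carrier R \<Longrightarrow> s \<noteq> t \<Longrightarrow> t \<ominus> s \<in> units"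
  by (auto simp: units_def)

lemma not_incident_self: "a \<in> carrier R \<Longrightarrow> b \<in> carrier R \<Longrightarrow> i \<in> proj_line \<Longrightarrow> \<not> incident i a i b"
  by (auto simp: incident_def proj_line_def minus_eq r_neg)

lemma ex1_incident:
  assumes "i \<in> proj_line" "j \<in> proj_line" "i \<noteq> j" "a \<in> units"
  shows "\<exists>!b. b \<in> units \<and> incident i a j b"
proof -
  \<comment> \<open>Up to sign, \<open>x\<close> is the determinant of the given vector with the
    direction vector of \<open>j\<close>; it is nonzero because the directions differ.\<close>
  define x where "x = (case (i, j) of (Some s, Some t) \<Rightarrow> a \<otimes> (t \<ominus> s) | _ \<Rightarrow> a)"
  have "x \<in> units"
    using assms by (auto simp: x_def proj_line_def intro!: mult_units minus_units)
  moreover have "incident i a j b \<longleftrightarrow> b \<otimes> x = \<one>" for b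
    using assms(3) by (auto simp: incident_def x_def split: option.splits)
  ultimately show ?thesis using ex1_unit_inverse by simp
qed

lemma ex1_linear:
  assumes "c \<in> units" "d \<in> carrier R"
  shows "\<exists>!t. t \<in> carrier R \<and> c \<otimes> t = d"
proof -
  obtain c' where c': "c' \<in> carrier R" "c' \<otimes> c = \<one>"
    using ex1_unit_inverse[OF assms(1)] by (auto simp: units_def)
  have c: "c \<in> carrier R" using assms(1) by (simp add: units_def)
  show ?thesis
  proof (rule ex1I)
    show "c' \<otimes> d \<in> carrier R \<and> c \<otimes> (c' \<otimes> d) = d"
      using c c' assms(2) by (metis l_one m_assoc m_closed m_comm)
    show "t = c' \<otimes> d" if "t \<in> carrier R \<and> c \<otimes> t = d" for t
      using that c c' by (metis l_one m_assoc)
  qed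
qed

text \<open>Up to signs, the two incidences are linear equations for one vector whose coefficient
  vectors are independent, because the directions \<open>i\<close> and \<open>i'\<close> differ. In
  slope coordinates the unique solution is found by eliminating the scalar \<open>b\<close> and then
  solving for the slope.\<close>

lemma ex1_common_incident:
  assumes i: "i \<in> proj_line" "i' \<in> proj_line" "i \<noteq> i'" and a: "a \<in> units" "a' \<in> units"
  shows "\<exists>!(j, b). j \<in> proj_line \<and> b \<in> units \<and> incident i a j b \<and> incident i' a' j b"
proof -
  have carr: "a \<in> carrier R" "a' \<in> carrier R" using a by (auto simp: units_def)
  have one_infinite: "\<exists>!(j, b). j \<in> proj_line \<and> b \<in> units \<and> incident (Some s) a j b \<and> incident None a' j b"
    if s: "s \<in> carrier R" and a: "a \<in> units" "a' \<in> units" for s a a'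
  proof -
    have carr: "a \<in> carrier R" "a' \<in> carrier R" using a by (auto simp: units_def)
    \<comment> \<open>Comparing the two incidences gives
      \<open>a \<otimes> (t \<ominus> s) = a'\<close>, so \<open>w\<close> is the forced slope
      difference; \<open>b\<close> then comes from the second incidence alone.\<close>
    obtain w where w: "w \<in> carrier R" "a \<otimes> w = a'" "\<And>w'. w' \<in> carrier R \<Longrightarrow> a \<otimes> w' = a' \<Longrightarrow> w' = w"
      using ex1_linear[OF a(1) carr(2)] by (elim ex1E conjE) blast
    obtain b where b: "b \<in> units" "b \<otimes> a' = \<one>" "\<And>b'. b' \<in> units \<Longrightarrow> b' \<otimes> a' = \<one> \<Longrightarrow> b' = b"
      using ex1_unit_inverse[OF a(2)] by (elim ex1E conjE) blast
    have sw: "(s \<oplus> w) \<ominus> s = w" using s w(1) by algebra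
    show ?thesis
    proof (rule ex1I[of _ "(Some (s \<oplus> w), b)"])
      show "case (Some (s \<oplus> w), b) of (j, b) \<Rightarrow> j \<in> proj_line \<and> b \<in> units
          \<and> incident (Some s) a j b \<and> incident None a' j b"
        using s w(1,2) b(1,2) sw by (simp add: incident_def proj_line_def)
    next
      fix y assume "case y of (j, b) \<Rightarrow> j \<in> proj_line \<and> b \<in> units
          \<and> incident (Some s) a j b \<and> incident None a' j b"
      then obtain t b' where y: "y = (Some t, b')" "t \<in> carrier R" "b' \<in> units"
        "b' \<otimes> (a \<otimes> (t \<ominus> s)) = \<one>" "b' \<otimes> a' = \<one>"
        by (auto simp: incident_def proj_line_def)
      have "b' = b" using y b by blast
      moreover have "a \<otimes> (t \<ominus> s) = a'"
        using y(2-5) s carr mult_eq_oneD[of b' "a \<otimes> (t \<ominus> s)" a'] by (simp add: units_def)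
      then have "t \<ominus> s = w" using w(3)[of "t \<ominus> s"] y(2) s by simp
      moreover have "t = s \<oplus> (t \<ominus> s)"
        using y(2) s by algebra
      ultimately show "y = (Some (s \<oplus> w), b)" using y(1) by metis
    qed
  qed
  have both_finite: ?thesis if fin: "i = Some s" "i' = Some s'" "s \<in> carrier R" "s' \<in> carrier R" for s s'
  proof (cases "a = a'")
    \<comment> \<open>A finite slope would give \<open>t \<ominus> s = t \<ominus> s'\<close> after
      cancelling \<open>a\<close>, contradicting \<open>s \<noteq> s'\<close>; the solution
      therefore has direction \<open>None\<close>.\<close>
    case True
    obtain b where b: "b \<in> units" "b \<otimes> a = \<one>" "\<And>b'. b' \<in> units \<Longrightarrow> b' \<otimes> a = \<one> \<Longrightarrow> b' = b"
      using ex1_unit_inverse[OF a(1)] by (elim ex1E conjE) blast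
    show ?thesis
    proof (rule ex1I[of _ "(None, b)"])
      show "case (None, b) of (j, b) \<Rightarrow> j \<in> proj_line \<and> b \<in> units \<and> incident i a j b \<and> incident i' a' j b"
        using fin b(1,2) True by (simp add: incident_def proj_line_def)
    next
      fix y assume y: "case y of (j, b) \<Rightarrow> j \<in> proj_line \<and> b \<in> units \<and> incident i a j b \<and> incident i' a' j b"
      obtain j b' where jb: "y = (j, b')" by fastforce
      show "y = (None, b)"
      proof (cases j)
        case None
        then show ?thesis using y jb b(3)[of b'] fin by (auto simp: incident_def)
      next
        case (Some t)
        then have t: "t \<in> carrier R" "b' \<in> carrier R" "b' \<otimes> (a \<otimes> (t \<ominus> s)) = \<one>" "b' \<otimes> (a \<otimes> (t \<ominus> s')) = \<one>"
          using y jb fin True by (auto simp: incident_def proj_line_def units_def)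
        then have "a \<otimes> (t \<ominus> s) = a \<otimes> (t \<ominus> s')"
          using fin carr mult_eq_oneD[of b' "a \<otimes> (t \<ominus> s)" "a \<otimes> (t \<ominus> s')"] by simp
        then have "t \<ominus> s = t \<ominus> s'"
          using a(1) t(1) fin m_lcancel by (auto simp: units_def)
        then have "t \<ominus> (t \<ominus> s) = t \<ominus> (t \<ominus> s')" by simp
        moreover have "t \<ominus> (t \<ominus> s) = s" using t fin by algebra
        moreover have "t \<ominus> (t \<ominus> s') = s'" using t fin by algebra
        ultimately show ?thesis using i(3) fin by simp
      qed
    qed
  next
    case False
    \<comment> \<open>Eliminating the scalar leaves a linear equation for the slope, whose leading
      coefficient \<open>a \<ominus> a'\<close> is invertible in this case.\<close>
    have eq_iff: "a \<otimes> (t \<ominus> s) = a' \<otimes> (t \<ominus> s') \<longleftrightarrow> (a \<ominus> a') \<otimes> t = a \<otimes> s \<ominus> a' \<otimes> s'"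
      if t: "t \<in> carrier R" for t
    proof -
      have "a \<otimes> (t \<ominus> s) \<ominus> a' \<otimes> (t \<ominus> s') = (a \<ominus> a') \<otimes> t \<ominus> (a \<otimes> s \<ominus> a' \<otimes> s')"
        using t fin carr by algebra
      moreover have "(a \<otimes> (t \<ominus> s) = a' \<otimes> (t \<ominus> s')) \<longleftrightarrow> a \<otimes> (t \<ominus> s) \<ominus> a' \<otimes> (t \<ominus> s') = \<zero>"
        using t fin carr by simp
      moreover have "((a \<ominus> a') \<otimes> t = a \<otimes> s \<ominus> a' \<otimes> s')
          \<longleftrightarrow> (a \<ominus> a') \<otimes> t \<ominus> (a \<otimes> s \<ominus> a' \<otimes> s') = \<zero>"
        using t fin carr by simp
      ultimately show ?thesis by (simp only:)
    qed
    have "a \<ominus> a' \<in> units"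
      using minus_units[of a' a] False carr by simp
    moreover have "a \<otimes> s \<ominus> a' \<otimes> s' \<in> carrier R"
      using carr fin by simp
    ultimately have "\<exists>!t. t \<in> carrier R \<and> (a \<ominus> a') \<otimes> t = a \<otimes> s \<ominus> a' \<otimes> s'"
      by (rule ex1_linear)
    then obtain t where t: "t \<in> carrier R" "(a \<ominus> a') \<otimes> t = a \<otimes> s \<ominus> a' \<otimes> s'"
      "\<And>t'. t' \<in> carrier R \<Longrightarrow> (a \<ominus> a') \<otimes> t' = a \<otimes> s \<ominus> a' \<otimes> s' \<Longrightarrow> t' = t"
      by (elim ex1E conjE) blast
    have teq: "a \<otimes> (t \<ominus> s) = a' \<otimes> (t \<ominus> s')"
      using eq_iff[OF t(1)] t(2) by simp
    have "t \<noteq> s"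
    proof
      assume "t = s"
      then have "a' \<otimes> (s \<ominus> s') = \<zero>" using teq fin carr by (simp add: minus_eq r_neg)
      then have "s \<ominus> s' = \<zero>" using a(2) fin integral[of a' "s \<ominus> s'"] by (simp add: units_def)
      then show False using fin i(3) by simp
    qed
    then have "a \<otimes> (t \<ominus> s) \<in> units"
      using a(1) t(1) fin by (intro mult_units minus_units) auto
    from ex1_unit_inverse[OF this] obtain b where b: "b \<in> units" "b \<otimes> (a \<otimes> (t \<ominus> s)) = \<one>"
      "\<And>b'. b' \<in> units \<Longrightarrow> b' \<otimes> (a \<otimes> (t \<ominus> s)) = \<one> \<Longrightarrow> b' = b"
      by (elim ex1E conjE) blast
    show ?thesis
    proof (rule ex1I[of _ "(Some t, b)"])
      show "case (Some t, b) of (j, b) \<Rightarrow> j \<in> proj_line \<and> b \<in> units \<and> incident i a j b \<and> incident i' a' j b"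
        using fin b(1,2) t(1) teq[symmetric] by (simp add: incident_def proj_line_def)
    next
      fix y assume y: "case y of (j, b) \<Rightarrow> j \<in> proj_line \<and> b \<in> units \<and> incident i a j b \<and> incident i' a' j b"
      obtain j b' where jb: "y = (j, b')" by fastforce
      show "y = (Some t, b)"
      proof (cases j)
        case None
        then have "b' \<otimes> a = \<one>" "b' \<otimes> a' = \<one>" "b' \<in> carrier R"
          using y jb fin by (auto simp: incident_def units_def)
        then show ?thesis using mult_eq_oneD carr False by blast
      next
        case (Some t')
        then have t': "t' \<in> carrier R" "b' \<in> units" "b' \<otimes> (a \<otimes> (t' \<ominus> s)) = \<one>" "b' \<otimes> (a' \<otimes> (t' \<ominus> s')) = \<one>"
          using y jb fin by (auto simp: incident_def proj_line_def)
        then have "a \<otimes> (t' \<ominus> s) = a' \<otimes> (t' \<ominus> s')"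
          using fin carr mult_eq_oneD[of b' "a \<otimes> (t' \<ominus> s)" "a' \<otimes> (t' \<ominus> s')"] by (simp add: units_def)
        then have "t' = t" using eq_iff[OF t'(1)] t(3)[OF t'(1)] by simp
        then show ?thesis using t'(2,3) b(3)[of b'] jb Some by simp
      qed
    qed
  qed
  show ?thesis
  proof (cases i)
    case None
    then obtain s where s: "i' = Some s" "s \<in> carrier R"
      using i by (auto simp: proj_line_def)
    have "(\<lambda>(j, b). j \<in> proj_line \<and> b \<in> units \<and> incident i a j b \<and> incident i' a' j b)
      = (\<lambda>(j, b). j \<in> proj_line \<and> b \<in> units \<and> incident (Some s) a' j b \<and> incident None a j b)"
      using None s by (auto simp: fun_eq_iff)
    then show ?thesis
      using one_infinite[OF s(2) a(2,1)] by simp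
  next
    case s: (Some s)
    then have "s \<in> carrier R" using i(1) by (auto simp: proj_line_def)
    show ?thesis
    proof (cases i')
      case None
      then show ?thesis using one_infinite[OF \<open>s \<in> carrier R\<close> a] s by simp
    next
      case s': (Some s')
      then have "s' \<in> carrier R" using i(2) by (auto simp: proj_line_def)
      from both_finite[OF s s' \<open>s \<in> carrier R\<close> this] show ?thesis .
    qed
  qed
qed

definition neg :: "'a option \<Rightarrow> 'a option" where
  "neg = map_option (\<lambda>s. \<ominus> s)"

lemma neg_proj_line: "i \<in> proj_line \<Longrightarrow> neg i \<in> proj_line"
  by (auto simp: neg_def proj_line_def)

lemma neg_neg: "i \<in> proj_line \<Longrightarrow> neg (neg i) = i"
  by (auto simp: neg_def proj_line_def)

text \<open>Negating all slopes exchanges the roles of points and lines.\<close>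
lemma incident_swap:
  assumes "i \<in> proj_line" "j \<in> proj_line" "a \<in> carrier R" "b \<in> carrier R"
  shows "incident i a j b \<longleftrightarrow> incident (neg j) b (neg i) a"
proof -
  have "b \<otimes> (a \<otimes> (t \<ominus> s)) = a \<otimes> (b \<otimes> (\<ominus> s \<ominus> \<ominus> t))" if "s \<in> carrier R" "t \<in> carrier R" for s t
    using that assms(3,4) by algebra
  then show ?thesis
    using assms m_comm[OF assms(3,4)] by (auto simp: incident_def neg_def proj_line_def)
qed

lemma ex1_incident':
  assumes "i \<in> proj_line" "j \<in> proj_line" "i \<noteq> j" "b \<in> units"
  shows "\<exists>!a. a \<in> units \<and> incident i a j b"
proof -
  have "neg i \<noteq> neg j" using assms neg_neg by metis
  then have "\<exists>!a. a \<in> units \<and> incident (neg j) b (neg i) a"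
    using assms by (intro ex1_incident neg_proj_line) auto
  moreover have "a \<in> units \<and> incident (neg j) b (neg i) a \<longleftrightarrow> a \<in> units \<and> incident i a j b" for a
    using incident_swap[of i j a b] assms by (auto simp: units_def)
  ultimately show ?thesis by simp
qed

lemma ex1_common_incident':
  assumes j: "j \<in> proj_line" "j' \<in> proj_line" "j \<noteq> j'" and b: "b \<in> units" "b' \<in> units"
  shows "\<exists>!(i, a). i \<in> proj_line \<and> a \<in> units \<and> incident i a j b \<and> incident i a j' b'"
proof -
  have "neg j \<noteq> neg j'" using j neg_neg by metis
  from ex1_common_incident[OF neg_proj_line[OF j(1)] neg_proj_line[OF j(2)] this b]
  obtain i a where ia: "i \<in> proj_line" "a \<in> units" "incident (neg j) b i a" "incident (neg j') b' i a"
    and uniq: "\<And>i' a'. i' \<in> proj_line \<Longrightarrow> a' \<in> units \<Longrightarrow> incident (neg j) b i' a'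
      \<Longrightarrow> incident (neg j') b' i' a' \<Longrightarrow> (i', a') = (i, a)"
    by (elim ex1E) (simp only: split_paired_All split_beta fst_conv snd_conv, blast)
  have swap: "incident (neg j) b (neg i) a \<longleftrightarrow> incident i a j b" "incident (neg j') b' (neg i) a \<longleftrightarrow> incident i a j' b'"
    if "i \<in> proj_line" "a \<in> units" for i a
    using that incident_swap[of i j a b] incident_swap[of i j' a b'] j b by (auto simp: units_def)
  show ?thesis
  proof (rule ex1I[of _ "(neg i, a)"])
    show "case (neg i, a) of (i, a) \<Rightarrow> i \<in> proj_line \<and> a \<in> units \<and> incident i a j b \<and> incident i a j' b'"
      using ia swap[of "neg i" a] neg_neg neg_proj_line by simp
  next
    fix y assume "case y of (i, a) \<Rightarrow> i \<in> proj_line \<and> a \<in> units \<and> incident i a j b \<and> incident i a j' b'"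
    then obtain i' a' where y: "y = (i', a')" "i' \<in> proj_line" "a' \<in> units" "incident i' a' j b" "incident i' a' j' b'"
      by auto
    then have "(neg i', a') = (i, a)"
      using swap[of i' a'] by (intro uniq neg_proj_line) auto
    then show "y = (neg i, a)" using y neg_neg by auto
  qed
qed

end

text \<open>Mixed radix digits: a vertex is \<open>(2 * j + of_bool \<sigma>) * r + i\<close>, with
  direction \<open>j\<close>, side \<open>\<sigma>\<close> and \<open>i\<close> indexing the nonzero
  scalars. The direction is the leading digit, so that the first directions occupy an initial
  segment.\<close>

lemma ex1_nat_coordinates:
  fixes r :: nat
  assumes "i < r"
  shows "\<exists>!v. v div (2 * r) = j \<and> odd (v div r) = \<sigma> \<and> v mod r = i"
proof (rule ex1I)
  have "((2 * j + of_bool \<sigma>) * r + i) div r = 2 * j + of_bool \<sigma>"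
    using assms by simp
  then show "((2 * j + of_bool \<sigma>) * r + i) div (2 * r) = j \<and> odd (((2 * j + of_bool \<sigma>) * r + i) div r) = \<sigma>
      \<and> ((2 * j + of_bool \<sigma>) * r + i) mod r = i"
    using assms by (auto simp: mult.commute[of 2] div_mult2_eq simp del: div_mult_self1 div_mult_self2 div_mult_self3 div_mult_self4)
next
  fix v assume v: "v div (2 * r) = j \<and> odd (v div r) = \<sigma> \<and> v mod r = i"
  then have "v div r div 2 = j"
    by (simp add: div_mult2_eq mult.commute[of 2])
  moreover have "v div r mod 2 = of_bool \<sigma>"
    using v by (simp add: mod_2_eq_odd)
  moreover have "v div r = 2 * (v div r div 2) + v div r mod 2"
    by simp
  ultimately have quot: "v div r = 2 * j + of_bool \<sigma>"
    by (simp only:)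
  have "v = v div r * r + v mod r" by simp
  also have "v mod r = i" using v by simp
  finally show "v = (2 * j + of_bool \<sigma>) * r + i" unfolding quot .
qed

lemma card_nat_coordinates:
  fixes r :: nat
  assumes "r > 0"
  shows "card {v. v div (2 * r) = j \<and> odd (v div r) = \<sigma>} = r"
proof -
  have "bij_betw (\<lambda>v. v mod r) {v. v div (2 * r) = j \<and> odd (v div r) = \<sigma>} {..<r}"
    unfolding bij_betw_def
  proof
    show "inj_on (\<lambda>v. v mod r) {v. v div (2 * r) = j \<and> odd (v div r) = \<sigma>}"
    proof (rule inj_onI)
      fix u v assume "u \<in> {v. v div (2 * r) = j \<and> odd (v div r) = \<sigma>}"
        "v \<in> {v. v div (2 * r) = j \<and> odd (v div r) = \<sigma>}" "u mod r = v mod r"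
      then show "u = v"
        using ex1_nat_coordinates[of "v mod r" r j \<sigma>] assms by auto
    qed
    have "\<exists>v. v div (2 * r) = j \<and> odd (v div r) = \<sigma> \<and> v mod r = i" if "i < r" for i
      using ex1_nat_coordinates[OF that] by (rule ex1_implies_ex)
    then show "(\<lambda>v. v mod r) ` {v. v div (2 * r) = j \<and> odd (v div r) = \<sigma>} = {..<r}"
      using assms by (auto simp: image_iff)
  qed
  from bij_betw_same_card[OF this] show ?thesis by simp
qed

theorem elliptic_design_exists:
  assumes "primepow (q::nat)"
  shows "\<exists>grp side adj. elliptic_design q (q - 1) grp side adj"
proof -
  obtain R :: "complex ring" where R: "field R" "card (carrier R) = q"
    using finite_field_exists[OF assms] by blast
  interpret field R by fact
  define r where "r = q - 1"
  have "q > 1" using primepow_gt_Suc_0[OF assms] by simp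
  then have r: "r > 0" "q = r + 1" by (auto simp: r_def)
  have fin: "finite (carrier R)" using R(2) \<open>q > 1\<close> card.infinite by fastforce
  have "card units = r"
    using fin R(2) r by (simp add: units_def)
  then obtain f where f: "bij_betw f {..<r} units"
    using ex_bij_betw_nat_finite[of units] fin by (auto simp: units_def lessThan_atLeast0)
  have "card proj_line = q + 1" "finite proj_line"
    using fin R(2) by (auto simp: proj_line_def card_image)
  then obtain E where E: "bij_betw E {..q} proj_line"
    using ex_bij_betw_nat_finite[of proj_line] by (auto simp: atLeast0LessThan lessThan_Suc_atMost)
  define grp where "grp v = v div (2 * r)" for v
  define side where "side v = odd (v div r)" for v
  define lab where "lab v = E (grp v)" for v
  define elt where "elt v = f (v mod r)" for v
  \<comment> \<open>Since \<open>incident\<close> expects the point first and the line second, both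
    orientations are listed. The enumeration \<open>E\<close> is controlled only up to
    \<open>q\<close>, so vertices beyond that range get no neighbours.\<close>
  define adj where "adj u v \<longleftrightarrow> grp u \<le> q \<and> grp v \<le> q \<and> grp u \<noteq> grp v \<and>
    (\<not> side u \<and> side v \<and> incident (lab u) (elt u) (lab v) (elt v)
     \<or> side u \<and> \<not> side v \<and> incident (lab v) (elt v) (lab u) (elt u))" for u v
  have lab: "lab v \<in> proj_line" if "grp v \<le> q" for v
    using that E by (auto simp: lab_def bij_betw_def)
  have lab_eq: "lab u = lab v \<longleftrightarrow> grp u = grp v" if "grp u \<le> q" "grp v \<le> q" for u v
    using that E by (auto simp: lab_def bij_betw_def inj_on_def)
  have elt: "elt v \<in> units" for v
    using f r by (auto simp: elt_def bij_betw_def)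
  have vertex: "\<exists>!v. grp v \<le> q \<and> side v = \<sigma> \<and> lab v = j \<and> elt v = b" if jb: "j \<in> proj_line" "b \<in> units" for \<sigma> j b
  proof -
    have "j \<in> E ` {..q}" "b \<in> f ` {..<r}"
      using bij_betw_imp_surj_on[OF E] bij_betw_imp_surj_on[OF f] jb by simp_all
    then obtain t i where t: "t \<le> q" "E t = j" and i: "i < r" "f i = b" by auto
    have "grp v \<le> q \<and> lab v = j \<longleftrightarrow> grp v = t" for v
      using t E by (auto simp: lab_def bij_betw_def inj_on_def)
    moreover have "elt v = b \<longleftrightarrow> v mod r = i" for v
      using i f r by (auto simp: elt_def bij_betw_def inj_on_def)
    ultimately show ?thesis
      using ex1_nat_coordinates[OF i(1), of t \<sigma>] unfolding grp_def[symmetric] side_def[symmetric] by metis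
  qed
  have "elliptic_design q r grp side adj"
  proof
    show "r > 0" "q = r + 1" by fact+
    show "grp v < j \<longleftrightarrow> v < 2 * j * r" for v j
      using r by (simp add: grp_def div_less_iff_less_mult mult_ac)
    show "card {v. grp v = \<gamma> \<and> side v = \<sigma>} = r" for \<gamma> \<sigma>
      using card_nat_coordinates[OF r(1)] by (simp add: grp_def side_def)
    show "adj u v \<longleftrightarrow> adj v u" for u v by (auto simp: adj_def)
    show "adj u v \<Longrightarrow> side u \<noteq> side v" "adj u v \<Longrightarrow> grp u \<noteq> grp v" for u v by (auto simp: adj_def)
  next
    fix u j assume u: "grp u \<le> q" "j \<le> q" "j \<noteq> grp u"
    have j: "E j \<in> proj_line" "E j \<noteq> lab u" and grp_eq: "\<And>v. grp v \<le> q \<Longrightarrow> grp v = j \<longleftrightarrow> lab v = E j"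
      using u E by (auto simp: lab_def bij_betw_def inj_on_def)
    define Q where "Q b = (if side u then incident (E j) b (lab u) (elt u)
      else incident (lab u) (elt u) (E j) b)" for b
    have adj_iff: "grp v = j \<and> adj u v \<longleftrightarrow> grp v \<le> q \<and> side v = (\<not> side u) \<and> lab v = E j \<and> Q (elt v)" for v
      using u j grp_eq[of v] by (auto simp: adj_def Q_def)
    have "\<exists>!b. b \<in> units \<and> Q b"
      using ex1_incident[OF lab[OF u(1)] j(1) j(2)[symmetric] elt[of u]]
        ex1_incident'[OF j(1) lab[OF u(1)] j(2) elt[of u]] by (cases "side u") (simp_all add: Q_def)
    then obtain b where b: "b \<in> units" "Q b" "\<And>b'. b' \<in> units \<Longrightarrow> Q b' \<Longrightarrow> b' = b"
      by (elim ex1E conjE) blast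
    have "grp v = j \<and> adj u v \<longleftrightarrow> grp v \<le> q \<and> side v = (\<not> side u) \<and> lab v = E j \<and> elt v = b" for v
      unfolding adj_iff using b elt[of v] by blast
    then show "\<exists>!v. grp v = j \<and> adj u v"
      using vertex[OF j(1) b(1)] by simp
  next
    fix u v assume uv: "grp u \<le> q" "grp v \<le> q" "side u = side v" "grp u \<noteq> grp v"
    define P where "P i a = (if side u then incident i a (lab u) (elt u) \<and> incident i a (lab v) (elt v)
      else incident (lab u) (elt u) i a \<and> incident (lab v) (elt v) i a)" for i a
    have "lab u \<noteq> lab v" using lab_eq uv by simp
    then have "\<exists>!(i, a). i \<in> proj_line \<and> a \<in> units \<and> P i a"
      using ex1_common_incident[OF lab[OF uv(1)] lab[OF uv(2)] _ elt elt]
        ex1_common_incident'[OF lab[OF uv(1)] lab[OF uv(2)] _ elt elt]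
      by (cases "side u") (simp_all add: P_def)
    then obtain i a where ia: "i \<in> proj_line" "a \<in> units" "P i a"
      "\<And>i' a'. i' \<in> proj_line \<Longrightarrow> a' \<in> units \<Longrightarrow> P i' a' \<Longrightarrow> (i', a') = (i, a)"
      by (elim ex1E) (simp only: split_paired_All split_beta fst_conv snd_conv, blast)
    \<comment> \<open>The predicate \<open>P\<close> does not mention the different directions
      demanded by \<open>adj\<close>; they follow because incidence never holds within one
      direction.\<close>
    have grp_ne: "grp w \<noteq> grp u \<and> grp w \<noteq> grp v" if w: "grp w \<le> q" "P (lab w) (elt w)" for w
    proof -
      have "\<not> incident (lab x) (elt w) (lab x) (elt x)" "\<not> incident (lab x) (elt x) (lab x) (elt w)"
        if "grp x \<le> q" for x
        using not_incident_self[OF _ _ lab[OF that]] elt by (auto simp: units_def)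
      then show ?thesis
        using w uv lab_eq[of w u] lab_eq[of w v] by (auto simp: P_def split: if_splits)
    qed
    have common: "grp w \<le> q \<and> adj u w \<and> adj v w
      \<longleftrightarrow> grp w \<le> q \<and> side w = (\<not> side u) \<and> P (lab w) (elt w)" for w
      using uv grp_ne[of w] by (auto simp: adj_def P_def split: if_splits)
    have P_iff: "P (lab w) (elt w) \<longleftrightarrow> lab w = i \<and> elt w = a" if "grp w \<le> q" for w
      using ia(3) ia(4)[OF lab[OF that] elt[of w]] by auto
    have "grp w \<le> q \<and> adj u w \<and> adj v w
      \<longleftrightarrow> grp w \<le> q \<and> side w = (\<not> side u) \<and> lab w = i \<and> elt w = a" for w
      using common[of w] P_iff[of w] by blast
    then show "\<exists>!w. grp w \<le> q \<and> adj u w \<and> adj v w"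
      using vertex[OF ia(1,2)] by simp
  qed
  then show ?thesis unfolding r_def by blast
qed

theorem theorem4p1:
  fixes k l :: nat
  assumes "k > 0"
    and "l = (LEAST m. primepow (k + m))"
  shows "\<exists>G :: nat pair_pre_digraph. regular_graph k G \<and> pverts G \<noteq> {} \<and>
    energy_per_vertex G \<ge>
      (2 * real k + real l
        + sqrt (real k + real l) * ((real k)\<^sup>2 - (real l)\<^sup>2 + real l - real k - 2))
      / ((real k + 1) * (real k + real l - 1))"
proof -
  \<comment> \<open>A prime above \<open>k\<close> shows that some \<open>k + m\<close> is a prime
    power, so the minimum defining \<open>l\<close> is attained.\<close>
  obtain p :: nat where p: "prime p" "p > k" using bigger_prime by blast
  then have "primepow (k + (p - k))" by (simp add: primepow_prime)
  then have q: "primepow (k + l)" unfolding assms(2) by (rule LeastI)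
  then have "k + l \<ge> 2" using primepow_gt_Suc_0[OF q] by simp
  obtain grp side adj where design: "elliptic_design (k + l) (k + l - 1) grp side adj"
    using elliptic_design_exists[OF q] by blast
  interpret elliptic_design "k + l" "k + l - 1" grp side adj by fact
  \<comment> \<open>Keeping \<open>k + 1\<close> of the \<open>k + l + 1\<close> directions gives
    degree \<open>k\<close>.\<close>
  interpret elliptic_subdesign "k + l" "k + l - 1" grp side adj "k + 1"
    by unfold_locales auto
  have "energy_per_vertex G \<ge>
      (4 * real k + 2 * real (k + 1) * real k * (real (k + l) - 2) / sqrt (k + l))
      / (2 * real (k + 1) * (real (k + l) - 1))"
    using energy_per_vertex_G_ge \<open>k + l \<ge> 2\<close> by (simp add: of_nat_diff algebra_simps)
  moreover have "pverts G \<noteq> {}"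
    unfolding G_def using \<open>k + l \<ge> 2\<close> by (auto simp: lessThan_empty_iff)
  ultimately show ?thesis
    using regular_graph_G energy_bound_arith[OF assms(1) \<open>k + l \<ge> 2\<close>]
    by (intro exI[of _ G]) auto
qed

end
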